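(* For every integer $k \geq 6$, \begin{align*} H^+(k+1,k) &= \left\{ 2^{k-1} + 2^{k-5} + 2^{k-6},~ 2^{k-1} + 2^{k-3},~ 2^{k-1} + 2^{k-2},~ 2^{k} \right\},\\ H^+(k+2,k) &= H^+(k+1,k) \cup\{ 2^{k-1} + 2^{k-4}\},\\ H^+(k+i,k) &= H^+(k+i-1,k)\cup \{ 2^{k-1} + 2^{k-(i+1)}\} \text{ for } i = 3, \dots, k-1,\\ H^+(k+i,k) &= H^+(2k-1,k) \text{ for all } i \geq k. \end{align*}
   Context: Let $\mathbb{H}^n=\{0,1\}^n\subseteq\mathbb{R}^n$. For $n\geq k$, $H(n,k)=\{\,|\mathbb{H}^k\cap L^{-1}(\mathbb{H}^{n-k})| : L:\mathbb{R}^k\to\mathbb{R}^{n-k}\text{ linear}\,\}$ (equivalently, the set of possible sizes of intersections of a $k$-dimensional linear subspace of $\mathbb{R}^n$ with $\mathbb{H}^n$), and $H^+(n,k)=H(n,k)\setminus\{1,\dots,2^{k-1}\}$. *)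

theory Defs
  imports Complex_Main
begin

definition cube :: "nat \<Rightarrow> (nat \<Rightarrow> real) set" where
  "cube k = {x. (\<forall>j<k. x j = 0 \<or> x j = 1) \<and> (\<forall>j\<ge>k. x j = 0)}"

text \<open>A linear map L : R^k -> R^(n-k) is given by its (n-k) x k matrix A,
  L(x)_i = sum_{j<k} A i j * x j.  H n k is the set of sizes of
  H^k \<inter> L^{-1}(H^(n-k)).\<close>
definition H :: "nat \<Rightarrow> nat \<Rightarrow> nat set" where
  "H n k = {card {x \<in> cube k. \<forall>i<n-k. (\<Sum>j<k. A i j * x j) = 0 \<or> (\<Sum>j<k. A i j * x j) = 1}
            | A :: nat \<Rightarrow> nat \<Rightarrow> real. True}"

definition Hplus :: "nat \<Rightarrow> nat \<Rightarrow> nat set" where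
  "Hplus n k = H n k - {1..2^(k-1)}"

end

theory Submission
  imports Defs
begin

text \<open>
  If more than half of the cube satisfies the system, all matrix entries are \<open>-1\<close>, \<open>0\<close> or \<open>1\<close>, since an edge of the
  cube in a direction with any other entry has at most one good endpoint. Rows with at most one nonzero entry are then
  redundant. A single remaining row is a pair of adjacent layers of a small cube, with density \<open>3/4\<close>, \<open>5/8\<close> or \<open>35/64\<close>.
  Two distinct rows have density \<open>5/8\<close> (star pairs) or \<open>9/16\<close>.

  Given a star pair, a half-cube \<open>mid\<close> is free for both rows and the excess over one half is only \<open>1/8\<close>. A further row
  that is nontrivial on \<open>mid\<close> kills at least that much, so all rows are trivial on \<open>mid\<close>; off \<open>mid\<close> each of them
  forces one coordinate of its own. Hence \<open>n\<close> rows give density \<open>1/2 + 1/2^(n+1)\<close>. Three rows without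
  a star pair have density at most \<open>1/2\<close>.
\<close>

section \<open>Counting subsets and two adjacent layers\<close>

text \<open>Supports of arbitrarily many rows cannot be enumerated, so only single rows and pairs
  are settled by a finite check; from three rows on, a star pair must fix the geometry. No pair with
  density over one half contains a row with more than five entries, so 35/64, which needs six or
  seven entries, comes from a single row only; this value is also the reason for
  \<open>k \<ge> 6\<close>. The star formula gives 3/4 and 5/8 for one and two rows, values that
  single rows attain as well, and 9/16 for three rows. But 9/16 = (3/4)^2 is attained by two rows
  with disjoint supports: it enters at \<open>i = 2\<close>, and the step \<open>i = 3\<close> adds
  nothing new. A star with \<open>n\<close> rows needs more than \<open>n\<close> coordinates, so
  the values stop changing at \<open>i = k - 1\<close>.\<close>

lemma card_Pow_insert:
  assumes "finite J" "j \<notin> J"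
  shows "card {X \<in> Pow (insert j J). P X} = card {X \<in> Pow J. P X} + card {X \<in> Pow J. P (insert j X)}"
proof -
  have eq: "{X \<in> Pow (insert j J). P X} = {X \<in> Pow J. P X} \<union> insert j ` {X \<in> Pow J. P (insert j X)}"
    by (auto simp: Pow_insert)
  have inj: "inj_on (insert j) {X \<in> Pow J. P (insert j X)}"
    using assms(2) by (intro inj_onI) (auto dest: insert_ident[THEN iffD1, rotated 2])
  have "{X \<in> Pow J. P X} \<inter> insert j ` {X \<in> Pow J. P (insert j X)} = {}"
    using assms(2) by auto
  then show ?thesis
    unfolding eq using assms(1) inj by (subst card_Un_disjoint) (auto simp: card_image)
qed

lemma card_Pow_remove:
  assumes "finite J" "j \<in> J"
  shows "card {X \<in> Pow J. P X} = card {X \<in> Pow (J - {j}). P X} + card {X \<in> Pow (J - {j}). P (insert j X)}"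
  using card_Pow_insert[of "J - {j}" j P] assms by (simp add: insert_absorb)

lemma card_Pow_le: "finite J \<Longrightarrow> card {X \<in> Pow J. P X} \<le> 2 ^ card J"
  by (subst card_Pow[symmetric]) (auto intro: card_mono)

lemma card_Pow_mono:
  assumes "finite J" "\<And>X. X \<subseteq> J \<Longrightarrow> P X \<Longrightarrow> Q X"
  shows "card {X \<in> Pow J. P X} \<le> card {X \<in> Pow J. Q X}"
  by (rule card_mono) (use assms in auto)

text \<open>The cube splits into edges in direction \<open>j\<close>, and each edge has at most one
  good endpoint.\<close>

lemma card_Pow_half:
  assumes "finite J" "j \<in> J" "\<And>X. X \<subseteq> J - {j} \<Longrightarrow> \<not> (P X \<and> P (insert j X))"
  shows "2 * card {X \<in> Pow J. P X} \<le> 2 ^ card J"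
proof -
  let ?J = "J - {j}"
  have "card {X \<in> Pow J. P X} = card ({X \<in> Pow ?J. P X} \<union> {X \<in> Pow ?J. P (insert j X)})"
    unfolding card_Pow_remove[OF assms(1,2)]
    by (rule card_Un_disjoint[symmetric]) (use assms in auto)
  also have "\<dots> \<le> card (Pow ?J)"
    by (rule card_mono) (use assms in auto)
  also have "2 * card (Pow ?J) = 2 ^ card J"
    using assms(1,2) card_Suc_Diff1[of J j] by (metis card_Pow finite_Diff power_Suc)
  finally show ?thesis by simp
qed

lemma card_Collect_insert:
  "finite J \<Longrightarrow> j \<notin> J \<Longrightarrow> card {i \<in> insert j J. P i} = card {i \<in> J. P i} + (if P j then 1 else 0)"
proof -
  assume "finite J" "j \<notin> J"
  then have "{i \<in> insert j J. P i} = (if P j then insert j {i \<in> J. P i} else {i \<in> J. P i})" by auto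
  with \<open>finite J\<close> \<open>j \<notin> J\<close> show ?thesis by simp
qed

text \<open>\<open>layers n c\<close> is the number of subsets of an \<open>n\<close>-set of size \<open>c\<close> or \<open>c + 1\<close>, that is
  \<open>n + 1 choose c + 1\<close>. \<open>layers2 A B E\<close> counts the subsets of \<open>P \<union> Q\<close> meeting \<open>P\<close> in \<open>c\<close> or \<open>c + 1\<close> and \<open>Q\<close> in
  \<open>d\<close> or \<open>d + 1\<close> elements, where \<open>P - Q\<close>, \<open>Q - P\<close>, \<open>P \<inter> Q\<close> have sizes \<open>A\<close>, \<open>B\<close>, \<open>E\<close>.\<close>

fun layers :: "nat \<Rightarrow> int \<Rightarrow> nat" where
  "layers 0 c = (if c = -1 \<or> c = 0 then 1 else 0)"
| "layers (Suc n) c = layers n c + layers n (c - 1)"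

fun layers2 :: "nat \<Rightarrow> nat \<Rightarrow> nat \<Rightarrow> int \<Rightarrow> int \<Rightarrow> nat" where
  "layers2 A B 0 c d = layers A c * layers B d"
| "layers2 A B (Suc E) c d = layers2 A B E c d + layers2 A B E (c - 1) (d - 1)"

lemma layers_g_numeral:
  "layers 1 c = layers 0 c + layers 0 (c - 1)"
  "layers (numeral n) c = layers (pred_numeral n) c + layers (pred_numeral n) (c - 1)"
  "layers2 A B 1 c d = layers2 A B 0 c d + layers2 A B 0 (c - 1) (d - 1)"
  "layers2 A B (numeral n) c d = layers2 A B (pred_numeral n) c d + layers2 A B (pred_numeral n) (c - 1) (d - 1)"
  by (simp_all add: numeral_eq_Suc)

lemma layers_outside: "c < -1 \<or> c > int n \<Longrightarrow> layers n c = 0"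
  by (induction n arbitrary: c) auto

lemma layers2_Suc_left: "layers2 (Suc A) B E c d = layers2 A B E c d + layers2 A B E (c - 1) d"
  by (induction E arbitrary: c d) (auto simp: algebra_simps)

lemma layers2_swap: "layers2 A B E c d = layers2 B A E d c"
  by (induction E arbitrary: c d) auto

lemma layers2_Suc_right: "layers2 A (Suc B) E c d = layers2 A B E c d + layers2 A B E c (d - 1)"
  using layers2_Suc_left[of B A E d c] by (simp add: layers2_swap)

lemma layers2_outside: "c < -1 \<or> c > int (A + E) \<Longrightarrow> layers2 A B E c d = 0"
  by (induction E arbitrary: c d) (auto simp: layers_outside)

lemma layers2_outside': "d < -1 \<or> d > int (B + E) \<Longrightarrow> layers2 A B E c d = 0"
  by (subst layers2_swap) (rule layers2_outside)

text \<open>By the recursion a count on \<open>n + 1\<close> coordinates is a sum of two counts on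
  \<open>n\<close>, so the largest density over all windows never increases.\<close>

lemma layers_mono:
  assumes "\<And>c. p * layers n c \<le> q * 2 ^ n" "n \<le> n'"
  shows "p * layers n' c \<le> q * 2 ^ n'"
  using assms(2)
proof (induction n' arbitrary: c rule: dec_induct)
  case base
  then show ?case by (rule assms(1))
next
  case (step m)
  from step.IH[of c] step.IH[of "c - 1"] show ?case by (simp add: algebra_simps)
qed

lemma layers_check:
  assumes "\<forall>c\<in>{-1..int n}. P (layers n c)" "P 0"
  shows "P (layers n c)"
  using assms layers_outside[of c n] by (cases "c < -1 \<or> c > int n") auto

lemma layers_le_3_4: "2 \<le> n \<Longrightarrow> 4 * layers n c \<le> 3 * 2 ^ n"
proof (rule layers_mono[of 4 2 3 n])
  have "\<forall>c\<in>{-1..int 2}. 4 * layers 2 c \<le> 3 * 2 ^ 2" by (simp add: layers_g_numeral simp_from_to)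
  then show "4 * layers 2 c \<le> 3 * 2 ^ 2" for c by (rule layers_check) simp
qed

lemma layers_le_1_2: "8 \<le> n \<Longrightarrow> 2 * layers n c \<le> 2 ^ n"
proof -
  have "\<forall>c\<in>{-1..int 8}. 2 * layers 8 c \<le> 1 * 2 ^ 8" by (simp add: layers_g_numeral simp_from_to)
  then have "2 * layers 8 c \<le> 1 * 2 ^ 8" for c by (rule layers_check) simp
  from layers_mono[of 2 8 1, OF this] show "8 \<le> n \<Longrightarrow> 2 * layers n c \<le> 2 ^ n" by simp
qed

text \<open>Only central binomial coefficients exceed one half: 3/4, 6/8, 10/16, 20/32, 35/64,
  70/128. At \<open>n = 8\<close> the largest density is 126/256, which ends the list.\<close>

lemma layers_values:
  assumes "2 \<le> n" "2 ^ n < 2 * layers n c"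
  shows "n \<in> {2,3} \<and> 4 * layers n c = 3 * 2 ^ n \<or> n \<in> {4,5} \<and> 8 * layers n c = 5 * 2 ^ n
    \<or> n \<in> {6,7} \<and> 64 * layers n c = 35 * 2 ^ n"
proof -
  have c: "\<forall>n\<in>{2,3,4,5,6,7}. \<forall>c\<in>{-1..int n}. 2 ^ n < 2 * layers n c \<longrightarrow> n \<in> {2,3} \<and> 4 * layers n c = 3 * 2 ^ n \<or> n \<in> {4,5} \<and> 8 * layers n c = 5 * 2 ^ n
    \<or> n \<in> {6,7} \<and> 64 * layers n c = 35 * 2 ^ n" by (simp only: ball_simps prod.case simp_thms) (simp add: layers_g_numeral simp_from_to)
  have n: "n \<in> {2,3,4,5,6,7}"
    using layers_le_1_2[of n c] assms by (cases "8 \<le> n") auto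
  have "2 ^ n < 2 * layers n c \<longrightarrow> n \<in> {2,3} \<and> 4 * layers n c = 3 * 2 ^ n \<or> n \<in> {4,5} \<and> 8 * layers n c = 5 * 2 ^ n
    \<or> n \<in> {6,7} \<and> 64 * layers n c = 35 * 2 ^ n"
    by (rule layers_check[OF bspec[OF c n]]) simp
  then show ?thesis using assms(2) by blast
qed

section \<open>Which pairs of supports can exceed one half\<close>

text \<open>A dead pattern stays dead when coordinates are added, so minimal dead patterns bound all others.\<close>

definition dead :: "nat \<Rightarrow> nat \<Rightarrow> nat \<Rightarrow> bool" where
  "dead A B E \<longleftrightarrow> (\<forall>c d. 2 * layers2 A B E c d \<le> 2 ^ (A + B + E))"

lemma dead_swap: "dead A B E \<longleftrightarrow> dead B A E"
  unfolding dead_def by (subst layers2_swap) (auto simp: add.commute)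

lemma dead_left: "dead A B E \<Longrightarrow> dead (A + n) B E"
proof (induction n)
  case (Suc n)
  show ?case unfolding dead_def
  proof (intro allI)
    fix c d
    have "2 * layers2 (A + n) B E c d \<le> 2 ^ (A + n + B + E)" "2 * layers2 (A + n) B E (c - 1) d \<le> 2 ^ (A + n + B + E)"
      using Suc by (auto simp: dead_def)
    then show "2 * layers2 (A + Suc n) B E c d \<le> 2 ^ (A + Suc n + B + E)" by (simp add: layers2_Suc_left)
  qed
qed simp

lemma dead_mid: "dead A B E \<Longrightarrow> dead A B (E + n)"
proof (induction n)
  case (Suc n)
  show ?case unfolding dead_def
  proof (intro allI)
    fix c d
    have "2 * layers2 A B (E + n) c d \<le> 2 ^ (A + B + (E + n))" "2 * layers2 A B (E + n) (c - 1) (d - 1) \<le> 2 ^ (A + B + (E + n))"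
      using Suc by (auto simp: dead_def)
    then show "2 * layers2 A B (E + Suc n) c d \<le> 2 ^ (A + B + (E + Suc n))" by simp
  qed
qed simp

lemma dead_mono:
  assumes "dead A B E" "A \<le> A'" "B \<le> B'" "E \<le> E'"
  shows "dead A' B' E'"
proof -
  have "dead A' B E" using dead_left[OF assms(1), of "A' - A"] assms(2) by simp
  then have "dead A' B' E" using dead_left[of B A' E "B' - B"] assms(3) by (simp add: dead_swap)
  then show ?thesis using dead_mid[of A' B' E "E' - E"] assms(4) by simp
qed

lemma layers2_check:
  assumes "\<forall>c\<in>{-1..int (A + E)}. \<forall>d\<in>{-1..int (B + E)}. P (layers2 A B E c d)" "P 0"
  shows "P (layers2 A B E c d)"
  using assms layers2_outside[of c A E B d] layers2_outside'[of d B E A c]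
  by (cases "(c < -1 \<or> c > int (A + E)) \<or> (d < -1 \<or> d > int (B + E))") auto

text \<open>Up to exchanging the rows these six are enough: under the side conditions of
  \<open>alive_cases\<close>, the patterns above none of them form its finite list. For instance,
  (4,2,0) has maximal density 5/8 times 3/4, which is 15/32.\<close>

lemma dead_cases: "\<forall>(A, B, E) \<in> {(4,2,0), (3,1,1), (3,0,2), (2,1,2), (1,1,3), (1,0,4)}. dead A B E"
proof -
  have "\<forall>(A, B, E) \<in> {(4,2,0), (3,1,1), (3,0,2), (2,1,2), (1,1,3), (1,0,4)}. 
     \<forall>c\<in>{-1..int (A + E)}. \<forall>d\<in>{-1..int (B + E)}. 2 * layers2 A B E c d \<le> 2 ^ (A + B + E)"
    by (simp only: ball_simps prod.case simp_thms) (simp add: layers_g_numeral simp_from_to)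
  note chk = this
  have "dead A B E" if t: "(A, B, E) \<in> {(4,2,0), (3,1,1), (3,0,2), (2,1,2), (1,1,3), (1,0,4)}" for A B E
    unfolding dead_def
  proof (intro allI)
    fix c d
    from bspec[OF chk t]
    have "\<forall>c\<in>{-1..int (A + E)}. \<forall>d\<in>{-1..int (B + E)}. 2 * layers2 A B E c d \<le> 2 ^ (A + B + E)"
      by (simp only: prod.case)
    then show "2 * layers2 A B E c d \<le> 2 ^ (A + B + E)" by (rule layers2_check) simp
  qed
  then show ?thesis by blast
qed

text \<open>\<open>0 < A + B\<close> leaves out equal supports: two equal rows count as one, so for
  small \<open>E\<close> such a pattern is not dead. Distinct rows with equal supports are left to
  \<open>card_same_supp_le\<close>. The first list leads to density 5/8, the second to 9/16.\<close>

lemma alive_cases: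
  assumes "\<not> dead A B E" "2 \<le> A + E" "2 \<le> B + E" "0 < A + B"
  shows "(A, B, E) \<in> {(1,1,1), (1,0,2), (0,1,2), (1,1,2)} \<union>
    {(2,2,0), (2,3,0), (3,2,0), (3,3,0), (2,1,1), (1,2,1), (2,2,1), (2,0,2), (0,2,2), (1,0,3), (0,1,3), (2,0,3), (0,2,3)}"
proof -
  have d: "\<not> (A0 \<le> A \<and> B0 \<le> B \<and> E0 \<le> E)" "\<not> (A0 \<le> B \<and> B0 \<le> A \<and> E0 \<le> E)"
    if "(A0, B0, E0) \<in> {(4,2,0), (3,1,1), (3,0,2), (2,1,2), (1,1,3), (1,0,4)}" for A0 B0 E0
    using dead_cases that assms(1) dead_mono[of A0 B0 E0 A B E] dead_mono[of A0 B0 E0 B A E] dead_swap[of A B E]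
    by blast+
  \<comment> \<open>Each fact excludes what lies above one dead pattern or its mirror image;
    together they bound every entry by 3 and leave a finite search.\<close>
  have n1: "\<not> (4 \<le> A \<and> 2 \<le> B) \<and> \<not> (4 \<le> B \<and> 2 \<le> A)"
    using d[of 4 2 0] by simp
  have n2: "\<not> (3 \<le> A \<and> 1 \<le> B \<and> 1 \<le> E) \<and> \<not> (3 \<le> B \<and> 1 \<le> A \<and> 1 \<le> E)"
    using d[of 3 1 1] by simp
  have n3: "\<not> (3 \<le> A \<and> 2 \<le> E) \<and> \<not> (3 \<le> B \<and> 2 \<le> E)"
    using d[of 3 0 2] by simp
  have n4: "\<not> (2 \<le> A \<and> 1 \<le> B \<and> 2 \<le> E) \<and> \<not> (2 \<le> B \<and> 1 \<le> A \<and> 2 \<le> E)"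
    using d[of 2 1 2] by simp
  have n5: "\<not> (1 \<le> A \<and> 1 \<le> B \<and> 3 \<le> E)"
    using d[of 1 1 3] by simp
  have n6: "\<not> (1 \<le> A \<and> 4 \<le> E) \<and> \<not> (1 \<le> B \<and> 4 \<le> E)"
    using d[of 1 0 4] by simp
  have "A \<le> 3 \<and> B \<le> 3 \<and> E \<le> 3"
    using n1 n2 n3 n6 assms(2-) by arith
  then have "A = 0 \<or> A = 1 \<or> A = 2 \<or> A = 3" "B = 0 \<or> B = 1 \<or> B = 2 \<or> B = 3"
    "E = 0 \<or> E = 1 \<or> E = 2 \<or> E = 3" by arith+
  then show ?thesis using n1 n2 n3 n4 n5 n6 assms(2-)
    by (elim disjE) simp_all
qed

lemma layers2_values:
  assumes "(A, B, E) \<in> {(1,1,1), (1,0,2), (0,1,2), (1,1,2)}" "2 ^ (A + B + E) < 2 * layers2 A B E c d"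
  shows "8 * layers2 A B E c d = 5 * 2 ^ (A + B + E)"
proof -
  have "\<forall>(A, B, E) \<in> {(1,1,1), (1,0,2), (0,1,2), (1,1,2)}. \<forall>c\<in>{-1..int (A + E)}. \<forall>d\<in>{-1..int (B + E)}.
     2 ^ (A + B + E) < 2 * layers2 A B E c d \<longrightarrow> 8 * layers2 A B E c d = 5 * 2 ^ (A + B + E)" by (simp only: ball_simps prod.case simp_thms) (simp add: layers_g_numeral simp_from_to)
  from bspec[OF this assms(1)]
  have "\<forall>c\<in>{-1..int (A + E)}. \<forall>d\<in>{-1..int (B + E)}.
     2 ^ (A + B + E) < 2 * layers2 A B E c d \<longrightarrow> 8 * layers2 A B E c d = 5 * 2 ^ (A + B + E)"
    by (simp only: prod.case)
  then have "2 ^ (A + B + E) < 2 * layers2 A B E c d \<longrightarrow> 8 * layers2 A B E c d = 5 * 2 ^ (A + B + E)"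
    by (rule layers2_check) simp
  then show ?thesis using assms(2) by blast
qed

lemma layers2_values':
  assumes "(A, B, E) \<in> {(2,2,0), (2,3,0), (3,2,0), (3,3,0), (2,1,1), (1,2,1), (2,2,1), (2,0,2), (0,2,2), (1,0,3), (0,1,3), (2,0,3), (0,2,3)}"
    "2 ^ (A + B + E) < 2 * layers2 A B E c d"
  shows "16 * layers2 A B E c d = 9 * 2 ^ (A + B + E)"
proof -
  have "\<forall>(A, B, E) \<in> {(2,2,0), (2,3,0), (3,2,0), (3,3,0), (2,1,1), (1,2,1), (2,2,1), (2,0,2), (0,2,2), (1,0,3), (0,1,3), (2,0,3), (0,2,3)}. 
     \<forall>c\<in>{-1..int (A + E)}. \<forall>d\<in>{-1..int (B + E)}.
     2 ^ (A + B + E) < 2 * layers2 A B E c d \<longrightarrow> 16 * layers2 A B E c d = 9 * 2 ^ (A + B + E)" by (simp only: ball_simps prod.case simp_thms) (simp add: layers_g_numeral simp_from_to)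
  from bspec[OF this assms(1)]
  have "\<forall>c\<in>{-1..int (A + E)}. \<forall>d\<in>{-1..int (B + E)}.
     2 ^ (A + B + E) < 2 * layers2 A B E c d \<longrightarrow> 16 * layers2 A B E c d = 9 * 2 ^ (A + B + E)"
    by (simp only: prod.case)
  then have "2 ^ (A + B + E) < 2 * layers2 A B E c d \<longrightarrow> 16 * layers2 A B E c d = 9 * 2 ^ (A + B + E)"
    by (rule layers2_check) simp
  then show ?thesis using assms(2) by blast
qed

section \<open>Systems of rows\<close>

definition signed_on :: "'a set \<Rightarrow> ('a \<Rightarrow> int) \<Rightarrow> bool" where
  "signed_on J r \<longleftrightarrow> (\<forall>j\<in>J. r j \<in> {-1, 0, 1})"

definition supp :: "'a set \<Rightarrow> ('a \<Rightarrow> int) \<Rightarrow> 'a set" where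
  "supp J r = {j \<in> J. r j \<noteq> 0}"

definition sols :: "'a set \<Rightarrow> ('a \<Rightarrow> int) set \<Rightarrow> 'a set set" where
  "sols J R = {X \<in> Pow J. \<forall>r\<in>R. sum r X \<in> {0, 1}}"

lemma finite_supp [simp]: "finite J \<Longrightarrow> finite (supp J r)"
  by (simp add: supp_def)

lemma sum_insert_Pow: "finite J \<Longrightarrow> j \<notin> J \<Longrightarrow> X \<in> Pow J \<Longrightarrow> sum r (insert j X) = r j + sum r X" for r :: "'a \<Rightarrow> int"
  by (subst sum.insert) (auto intro: finite_subset)

lemma window_shift: "(a::int) + x \<in> {c, c + 1} \<longleftrightarrow> x \<in> {c - a, c - a + 1}"
  by auto

text \<open>Replacing \<open>x\<^sub>j\<close> by \<open>1 - x\<^sub>j\<close> where the entry is \<open>-1\<close> makes all entries nonnegative and shifts the window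
  by the number of negative entries.\<close>

lemma card_single:
  assumes "finite J" "signed_on J r"
  shows "card {X \<in> Pow J. sum r X \<in> {c, c + 1}} =
    2 ^ card {j \<in> J. r j = 0} * layers (card (supp J r)) (c + card {j \<in> J. r j = -1})"
  using assms
proof (induction J arbitrary: c rule: finite_induct)
  case empty
  have "{X \<in> Pow {}. sum r X \<in> {c, c + 1}} = (if c = -1 \<or> c = 0 then {{}} else {})" by auto
  then show ?case by (simp add: supp_def)
next
  case (insert j J)
  have s: "signed_on J r" and rj: "r j = -1 \<or> r j = 0 \<or> r j = 1" using insert.prems by (auto simp: signed_on_def)
  have "card {X \<in> Pow J. sum r (insert j X) \<in> {c, c + 1}} = card {X \<in> Pow J. sum r X \<in> {c - r j, c - r j + 1}}"
    by (intro arg_cong[where f = card] Collect_cong conj_cong refl)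
      (simp_all only: sum_insert_Pow[OF insert.hyps(1,2)] window_shift)
  then have "card {X \<in> Pow (insert j J). sum r X \<in> {c, c + 1}} =
      2 ^ card {j \<in> J. r j = 0} * (layers (card (supp J r)) (c + card {j \<in> J. r j = -1}) +
      layers (card (supp J r)) (c - r j + card {j \<in> J. r j = -1}))"
    by (subst card_Pow_insert[OF insert.hyps(1,2)]) (simp only: insert.IH[OF s] distrib_left)
  then show ?case
    using rj insert.hyps unfolding supp_def
    by (elim disjE) (simp_all del: insert_iff add: card_Collect_insert algebra_simps)
qed

text \<open>Agreement on common entries lets the same reflections make both rows nonnegative at
  once.\<close>

lemma card_pair:
  assumes "finite J" "signed_on J a" "signed_on J b" "\<forall>j\<in>J. a j \<noteq> 0 \<longrightarrow> b j \<noteq> 0 \<longrightarrow> a j = b j"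
  shows "card {X \<in> Pow J. sum a X \<in> {c, c + 1} \<and> sum b X \<in> {d, d + 1}} =
    2 ^ card {j \<in> J. a j = 0 \<and> b j = 0} *
    layers2 (card {j \<in> J. a j \<noteq> 0 \<and> b j = 0}) (card {j \<in> J. a j = 0 \<and> b j \<noteq> 0}) (card {j \<in> J. a j \<noteq> 0 \<and> b j \<noteq> 0})
      (c + card {j \<in> J. a j = -1}) (d + card {j \<in> J. b j = -1})"
  using assms
proof (induction J arbitrary: c d rule: finite_induct)
  case empty
  have "{X \<in> Pow {}. sum a X \<in> {c, c + 1} \<and> sum b X \<in> {d, d + 1}} = (if (c = -1 \<or> c = 0) \<and> (d = -1 \<or> d = 0) then {{}} else {})"
    by auto
  then show ?case by simp
next
  case (insert j J)
  have s: "signed_on J a" "signed_on J b" "\<forall>j\<in>J. a j \<noteq> 0 \<longrightarrow> b j \<noteq> 0 \<longrightarrow> a j = b j"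
    using insert.prems by (auto simp: signed_on_def)
  have col: "a j = 0 \<and> b j = 0 \<or> a j = 0 \<and> b j = 1 \<or> a j = 0 \<and> b j = -1 \<or> a j = 1 \<and> b j = 0 \<or> a j = -1 \<and> b j = 0
    \<or> a j = 1 \<and> b j = 1 \<or> a j = -1 \<and> b j = -1"
  proof -
    have "a j \<in> {-1, 0, 1}" "b j \<in> {-1, 0, 1}" "a j \<noteq> 0 \<longrightarrow> b j \<noteq> 0 \<longrightarrow> a j = b j"
      using insert.prems unfolding signed_on_def by blast+
    then show ?thesis by auto
  qed
  have "card {X \<in> Pow J. sum a (insert j X) \<in> {c, c + 1} \<and> sum b (insert j X) \<in> {d, d + 1}} =
      card {X \<in> Pow J. sum a X \<in> {c - a j, c - a j + 1} \<and> sum b X \<in> {d - b j, d - b j + 1}}"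
    by (intro arg_cong[where f = card] Collect_cong conj_cong refl)
      (simp_all only: sum_insert_Pow[OF insert.hyps(1,2)] window_shift)
  then have "card {X \<in> Pow (insert j J). sum a X \<in> {c, c + 1} \<and> sum b X \<in> {d, d + 1}} =
      2 ^ card {j \<in> J. a j = 0 \<and> b j = 0} *
      (layers2 (card {j \<in> J. a j \<noteq> 0 \<and> b j = 0}) (card {j \<in> J. a j = 0 \<and> b j \<noteq> 0}) (card {j \<in> J. a j \<noteq> 0 \<and> b j \<noteq> 0})
        (c + card {j \<in> J. a j = -1}) (d + card {j \<in> J. b j = -1}) +
       layers2 (card {j \<in> J. a j \<noteq> 0 \<and> b j = 0}) (card {j \<in> J. a j = 0 \<and> b j \<noteq> 0}) (card {j \<in> J. a j \<noteq> 0 \<and> b j \<noteq> 0})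
        (c - a j + card {j \<in> J. a j = -1}) (d - b j + card {j \<in> J. b j = -1}))"
    by (subst card_Pow_insert[OF insert.hyps(1,2)]) (simp only: insert.IH[OF s] distrib_left)
  note e = this
  define z A B E p q where "z = card {j \<in> J. a j = 0 \<and> b j = 0}" and "A = card {j \<in> J. a j \<noteq> 0 \<and> b j = 0}"
    and "B = card {j \<in> J. a j = 0 \<and> b j \<noteq> 0}" and "E = card {j \<in> J. a j \<noteq> 0 \<and> b j \<noteq> 0}"
    and "p = card {j \<in> J. a j = -1}" and "q = card {j \<in> J. b j = -1}"
  note ab = z_def[symmetric] A_def[symmetric] B_def[symmetric] E_def[symmetric] p_def[symmetric] q_def[symmetric]
  show ?case
    unfolding e card_Collect_insert[OF insert.hyps(1,2)] ab
    using col by (elim disjE conjE) (simp_all add: layers2_Suc_left layers2_Suc_right algebra_simps)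
qed

section \<open>Pairs of rows\<close>

lemma sols_eq_Collect: "sols J R = {X \<in> Pow J. \<forall>r\<in>R. sum r X \<in> {0, 0 + 1}}"
  by (simp add: sols_def)

lemma finite_sols [simp]: "finite J \<Longrightarrow> finite (sols J R)"
  by (simp add: sols_def)

lemma sols_antimono: "R \<subseteq> R' \<Longrightarrow> sols J R' \<subseteq> sols J R"
  by (auto simp: sols_def)

lemma card_sols_antimono: "finite J \<Longrightarrow> R \<subseteq> R' \<Longrightarrow> card (sols J R') \<le> card (sols J R)"
  by (intro card_mono sols_antimono) auto

lemma signed_on_subset: "signed_on J r \<Longrightarrow> J' \<subseteq> J \<Longrightarrow> signed_on J' r"
  by (auto simp: signed_on_def)

lemma card_zeros_supp: "finite J \<Longrightarrow> card {j \<in> J. r j = 0} + card (supp J r) = card J"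
  unfolding supp_def by (subst card_Un_disjoint[symmetric]) (auto intro!: arg_cong[where f = card])

lemma card_single_supp:
  assumes "finite J" "signed_on J r"
  obtains c' where "2 ^ card (supp J r) * card {X \<in> Pow J. sum r X \<in> {c, c + 1}} = 2 ^ card J * layers (card (supp J r)) c'"
proof (rule that)
  show "2 ^ card (supp J r) * card {X \<in> Pow J. sum r X \<in> {c, c + 1}} =
      2 ^ card J * layers (card (supp J r)) (c + card {j \<in> J. r j = -1})"
    unfolding card_single[OF assms] card_zeros_supp[OF assms(1), of r, symmetric] by (simp add: power_add)
qed

text \<open>The first hypothesis says that \<open>x\<close> out of \<open>2 ^ k\<close> and
  \<open>y\<close> out of \<open>2 ^ n\<close> are equal densities; bounds on the cube over a
  support thus pass to the whole cube.\<close>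

lemma scale_le:
  fixes x :: nat
  assumes "2 ^ n * x = 2 ^ k * y" "p * y \<le> q * 2 ^ n"
  shows "p * x \<le> q * 2 ^ k"
proof -
  have "2 ^ n * (p * x) = 2 ^ k * (p * y)" using assms(1) by (metis mult.left_commute)
  also have "\<dots> \<le> 2 ^ k * (q * 2 ^ n)" using assms(2) by simp
  finally have "2 ^ n * (p * x) \<le> 2 ^ n * (q * 2 ^ k)" by (simp add: mult_ac)
  then show ?thesis by simp
qed

lemma scale_eq:
  fixes x :: nat
  assumes "2 ^ n * x = 2 ^ k * y" "p * y = q * 2 ^ n"
  shows "p * x = q * 2 ^ k"
proof -
  have "2 ^ n * (p * x) = 2 ^ k * (p * y)" using assms(1) by (metis mult.left_commute)
  then have "2 ^ n * (p * x) = 2 ^ n * (q * 2 ^ k)" using assms(2) by (simp add: mult_ac)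
  then show ?thesis by simp
qed

lemma scale_less:
  fixes x :: nat
  assumes "2 ^ n * x = 2 ^ k * y" "2 ^ k < 2 * x"
  shows "2 ^ n < 2 * y"
  using scale_le[OF assms(1), of 2 1] assms(2) by (simp add: linorder_not_le[symmetric]) blast

lemma card_single_le:
  assumes "finite J" "signed_on J r" "2 \<le> card (supp J r)"
  shows "4 * card {X \<in> Pow J. sum r X \<in> {c, c + 1}} \<le> 3 * 2 ^ card J"
proof -
  obtain c' where "2 ^ card (supp J r) * card {X \<in> Pow J. sum r X \<in> {c, c + 1}} = 2 ^ card J * layers (card (supp J r)) c'"
    using card_single_supp[OF assms(1,2)] .
  from scale_le[OF this layers_le_3_4[OF assms(3)]] show ?thesis .
qed

lemma all_if_card_full:
  assumes "finite J" "card {X \<in> Pow J. P X} = 2 ^ card J" "X \<subseteq> J"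
  shows "P X"
proof -
  have "{X \<in> Pow J. P X} = Pow J"
    by (rule card_subset_eq) (use assms in \<open>auto simp: card_Pow\<close>)
  then show ?thesis using assms(3) by blast
qed

text \<open>With at most one nonzero entry the density is 0, 1/2 or 1.\<close>

lemma card_single_small_supp:
  assumes "finite J" "signed_on J r" "card (supp J r) \<le> 1"
  shows "2 * card {X \<in> Pow J. sum r X \<in> {c, c + 1}} \<le> 2 ^ card J \<or> (\<forall>X\<subseteq>J. sum r X \<in> {c, c + 1})"
proof -
  obtain c' where c': "2 ^ card (supp J r) * card {X \<in> Pow J. sum r X \<in> {c, c + 1}} = 2 ^ card J * layers (card (supp J r)) c'"
    using card_single_supp[OF assms(1,2)] .
  have "2 * layers n c' \<le> 1 * 2 ^ n \<or> 1 * layers n c' = 1 * 2 ^ n" if "n = 0 \<or> n = 1" for n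
    using that by (elim disjE) (simp_all add: layers_g_numeral)
  then have "2 * layers (card (supp J r)) c' \<le> 1 * 2 ^ card (supp J r) \<or> 1 * layers (card (supp J r)) c' = 1 * 2 ^ card (supp J r)"
    using assms(3) by (simp add: le_Suc_eq)
  then show ?thesis
  proof
    assume "2 * layers (card (supp J r)) c' \<le> 1 * 2 ^ card (supp J r)"
    from scale_le[OF c' this] show ?thesis by simp
  next
    assume "1 * layers (card (supp J r)) c' = 1 * 2 ^ card (supp J r)"
    from scale_eq[OF c' this] have "card {X \<in> Pow J. sum r X \<in> {c, c + 1}} = 2 ^ card J" by (simp only: mult_1)
    from all_if_card_full[OF assms(1) this] show ?thesis by blast
  qed
qed

text \<open>The gap between 3/4 and 1 is what is used on slices: a row that excludes anything
  excludes at least a quarter.\<close>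

lemma card_single_dichotomy:
  assumes "finite J" "signed_on J r"
  shows "4 * card {X \<in> Pow J. sum r X \<in> {c, c + 1}} \<le> 3 * 2 ^ card J \<or>
    card (supp J r) \<le> 1 \<and> (\<forall>X\<subseteq>J. sum r X \<in> {c, c + 1})"
proof (cases "2 \<le> card (supp J r)")
  case False
  then show ?thesis using card_single_small_supp[OF assms, of c] by (auto simp del: insert_iff)
qed (use card_single_le[OF assms] in blast)

lemma card_single_values:
  assumes "finite J" "signed_on J r" "2 \<le> card (supp J r)" "2 ^ card J < 2 * card (sols J {r})"
  shows "card (supp J r) \<in> {2,3} \<and> 4 * card (sols J {r}) = 3 * 2 ^ card J
    \<or> card (supp J r) \<in> {4,5} \<and> 8 * card (sols J {r}) = 5 * 2 ^ card J
    \<or> card (supp J r) \<in> {6,7} \<and> 64 * card (sols J {r}) = 35 * 2 ^ card J"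
proof -
  obtain c' where c': "2 ^ card (supp J r) * card (sols J {r}) = 2 ^ card J * layers (card (supp J r)) c'"
    using card_single_supp[OF assms(1,2), of 0] unfolding sols_eq_Collect by auto
  from layers_values[OF assms(3) scale_less[OF c' assms(4)]] show ?thesis
    by (elim disjE conjE) (drule scale_eq[OF c'], simp only: simp_thms)+
qed

text \<open>The cube splits into two-dimensional faces in directions \<open>i\<close> and
  \<open>l\<close>; at most \<open>N\<close> good corners on each face give density at most
  \<open>N\<close>/4.\<close>

lemma card_Pow_four:
  assumes "finite J" "i \<in> J" "l \<in> J" "i \<noteq> l"
    and "\<And>X. X \<subseteq> J - {i} - {l} \<Longrightarrow>
      of_bool (P X) + of_bool (P (insert i X)) + of_bool (P (insert l X)) + of_bool (P (insert i (insert l X))) \<le> N"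
  shows "4 * card {X \<in> Pow J. P X} \<le> N * 2 ^ card J"
proof -
  let ?J = "J - {i} - {l}"
  have c: "card {X \<in> Pow ?J. Q X} = (\<Sum>X\<in>Pow ?J. of_bool (Q X))" for Q
    using assms(1) by (simp add: of_bool_def sum.inter_filter[symmetric])
  have "card {X \<in> Pow J. P X} = card {X \<in> Pow ?J. P X} + card {X \<in> Pow ?J. P (insert l X)}
     + (card {X \<in> Pow ?J. P (insert i X)} + card {X \<in> Pow ?J. P (insert i (insert l X))})"
    using assms by (subst card_Pow_remove[of J i], simp, simp) (subst (1 2) card_Pow_remove[of "J - {i}" l], simp_all)
  also have "\<dots> = (\<Sum>X\<in>Pow ?J. of_bool (P X) + of_bool (P (insert i X)) + of_bool (P (insert l X)) + of_bool (P (insert i (insert l X))))"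
    by (simp only: c sum.distrib)
  also have "\<dots> \<le> (\<Sum>X\<in>Pow ?J. N)"
    by (intro sum_mono assms(5)) auto
  also have "\<dots> = 2 ^ card ?J * N" using assms(1) by (simp add: card_Pow)
  finally have "card {X \<in> Pow J. P X} \<le> 2 ^ card ?J * N" .
  moreover have "card J = Suc (Suc (card ?J))"
    using assms(1-4) by (metis card_Suc_Diff1 finite_Diff insertE insert_Diff)
  ultimately show ?thesis by (simp add: mult.commute)
qed

lemma sum_insert_subset:
  fixes r :: "'a \<Rightarrow> int"
  assumes "finite J" "X \<subseteq> J - {j}"
  shows "sum r (insert j X) = r j + sum r X"
  using assms by (subst sum.insert) (auto intro: finite_subset)

lemma sum_insert_subset2:
  fixes r :: "'a \<Rightarrow> int"
  assumes "finite J" "X \<subseteq> J - {i} - {l}" "i \<noteq> l"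
  shows "sum r (insert i X) = r i + sum r X" "sum r (insert l X) = r l + sum r X"
    "sum r (insert i (insert l X)) = r i + r l + sum r X"
proof -
  have "finite X" "i \<notin> X" "l \<notin> X" using assms by (auto intro: finite_subset)
  then show "sum r (insert i X) = r i + sum r X" "sum r (insert l X) = r l + sum r X"
    "sum r (insert i (insert l X)) = r i + r l + sum r X" using assms(3) by simp_all
qed

text \<open>On a face in directions \<open>i\<close> and \<open>l\<close>, the equation for
  \<open>v\<close> fixes the choice at \<open>l\<close>, and then the one for \<open>u\<close> fixes
  the choice at \<open>i\<close>.\<close>

lemma card_two_equations_le:
  fixes u v :: "'a \<Rightarrow> int"
  assumes "finite J" "i \<in> J" "l \<in> J" "u i \<noteq> 0" "v i = 0" "v l \<noteq> 0"
  shows "4 * card {X \<in> Pow J. sum u X = \<alpha> \<and> sum v X = \<beta>} \<le> 2 ^ card J"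
proof -
  have "i \<noteq> l" using assms by auto
  have "4 * card {X \<in> Pow J. sum u X = \<alpha> \<and> sum v X = \<beta>} \<le> 1 * 2 ^ card J"
    by (rule card_Pow_four[OF assms(1-3) \<open>i \<noteq> l\<close>])
      (use assms(4-) in \<open>simp add: sum_insert_subset2[OF assms(1) _ \<open>i \<noteq> l\<close>] of_bool_def\<close>)
  then show ?thesis by simp
qed

text \<open>Along each diagonal of the face one of the two sums changes by 2 in absolute value,
  which no window of two consecutive integers allows. So each diagonal has at most one good
  corner.\<close>

lemma four_windows:
  fixes x y s t :: int
  assumes "s = 1 \<or> s = -1" "t = 1 \<or> t = -1"
  shows "of_bool (x \<in> {0, 1} \<and> y \<in> {0, 1}) + of_bool (s + x \<in> {0, 1} \<and> s + y \<in> {0, 1})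
    + of_bool (t + x \<in> {0, 1} \<and> - t + y \<in> {0, 1})
    + of_bool (s + t + x \<in> {0, 1} \<and> s + - t + y \<in> {0, 1}) \<le> (2::nat)"
  using assms by (elim disjE) (auto simp: of_bool_def)

lemma card_mixed_signs_le:
  assumes "finite J" "signed_on J a" "signed_on J b" "i \<in> J" "l \<in> J"
    "a i \<noteq> 0" "b i = a i" "a l \<noteq> 0" "b l = - a l"
  shows "2 * card (sols J {a, b}) \<le> 2 ^ card J"
proof -
  have "i \<noteq> l" using assms by auto
  have ai: "a i = 1 \<or> a i = -1" "a l = 1 \<or> a l = -1" using assms by (auto simp: signed_on_def)
  have "4 * card (sols J {a, b}) \<le> 2 * 2 ^ card J"
    unfolding sols_def ball_simps simp_thms
  proof (rule card_Pow_four[OF assms(1,4,5) \<open>i \<noteq> l\<close>], goal_cases)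
    case (1 X)
    show ?case
      using four_windows[OF ai, of "sum a X" "sum b X"]
      unfolding sum_insert_subset2[OF assms(1) 1 \<open>i \<noteq> l\<close>] assms(7,9) .
  qed
  then show ?thesis by simp
qed

text \<open>Entries agree up to sign. If both signs occur, \<open>card_mixed_signs_le\<close>
  applies. Otherwise \<open>b\<close> is \<open>- a\<close> on \<open>J\<close>, both windows
  together force the sum of \<open>a\<close> to be 0, and this fails at one end of every edge in
  direction \<open>j\<close>.\<close>

lemma card_same_supp_le:
  assumes "finite J" "signed_on J a" "signed_on J b" "supp J a = supp J b" "j \<in> J" "a j \<noteq> b j"
  shows "2 * card (sols J {a, b}) \<le> 2 ^ card J"
proof -
  have eq: "b i = a i \<or> b i = - a i" "a i \<noteq> 0 \<longleftrightarrow> b i \<noteq> 0" if "i \<in> J" for i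
  proof -
    have "a i \<in> {-1, 0, 1}" "b i \<in> {-1, 0, 1}" "a i \<noteq> 0 \<longleftrightarrow> b i \<noteq> 0"
      using assms(2-4) that unfolding signed_on_def supp_def by blast+
    then show "b i = a i \<or> b i = - a i" "a i \<noteq> 0 \<longleftrightarrow> b i \<noteq> 0" by auto
  qed
  have j: "a j \<noteq> 0" "b j = - a j" using eq[of j] assms(5,6) by auto
  show ?thesis
  proof (cases "\<exists>i\<in>J. a i \<noteq> 0 \<and> b i = a i")
    case True
    then show ?thesis using card_mixed_signs_le[OF assms(1-3)] assms(5) j by blast
  next
    case False
    then have "b i = - a i" if "i \<in> J" for i using eq[of i] that by auto
    then have neg: "sum b X = - sum a X" if "X \<subseteq> J" for X
      using that by (subst sum_negf[symmetric]) (auto intro!: sum.cong)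
    show ?thesis unfolding sols_def
    proof (rule card_Pow_half[OF assms(1,5)])
      fix X assume X: "X \<subseteq> J - {j}"
      then have "X \<subseteq> J" "insert j X \<subseteq> J" using assms(5) by auto
      then show "\<not> ((\<forall>r\<in>{a, b}. sum r X \<in> {0, 1}) \<and> (\<forall>r\<in>{a, b}. sum r (insert j X) \<in> {0, 1}))"
        using neg[of X] neg[of "insert j X"] sum_insert_subset[OF assms(1) X, of a] j(1) by auto
    qed
  qed
qed

definition overlap :: "'a set \<Rightarrow> ('a \<Rightarrow> int) \<Rightarrow> ('a \<Rightarrow> int) \<Rightarrow> nat \<times> nat \<times> nat" where
  "overlap J a b = (card (supp J a - supp J b), card (supp J b - supp J a), card (supp J a \<inter> supp J b))"

lemma card_supp_overlap:
  assumes "finite J" "overlap J a b = (A, B, E)"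
  shows "card (supp J a) = A + E" "card (supp J b) = B + E"
  using assms card_Diff_subset_Int[of "supp J a" "supp J b"] card_Diff_subset_Int[of "supp J b" "supp J a"]
    card_mono[of "supp J a" "supp J a \<inter> supp J b"] card_mono[of "supp J b" "supp J a \<inter> supp J b"]
  by (auto simp: overlap_def Int_commute)

text \<open>Two kinds of geometry: two 2-element supports sharing one coordinate, or distinct
  supports sharing exactly two coordinates with at most one private coordinate each.\<close>

definition star_types :: "(nat \<times> nat \<times> nat) set" where
  "star_types = {(1,1,1), (1,0,2), (0,1,2), (1,1,2)}"

text \<open>Either both supports have size 2 or 3 and each has a private coordinate, or a support of
  size 4 or 5 contains one of size 2 or 3. \<open>star_pair_exists\<close> rests on this
  split.\<close>

definition flat_types :: "(nat \<times> nat \<times> nat) set" where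
  "flat_types = {(2,2,0), (2,3,0), (3,2,0), (3,3,0), (2,1,1), (1,2,1), (2,2,1),
    (2,0,2), (0,2,2), (1,0,3), (0,1,3), (2,0,3), (0,2,3)}"

lemma card_pair_supp:
  assumes "finite J" "signed_on J a" "signed_on J b" "\<forall>j\<in>J. a j \<noteq> 0 \<longrightarrow> b j \<noteq> 0 \<longrightarrow> a j = b j"
    "overlap J a b = (A, B, E)"
  obtains c' d' where
    "2 ^ (A + B + E) * card {X \<in> Pow J. sum a X \<in> {c, c + 1} \<and> sum b X \<in> {d, d + 1}} = 2 ^ card J * layers2 A B E c' d'"
proof (rule that)
  let ?Z = "{j \<in> J. a j = 0 \<and> b j = 0}"
  have AB: "A = card {j \<in> J. a j \<noteq> 0 \<and> b j = 0}" "B = card {j \<in> J. a j = 0 \<and> b j \<noteq> 0}"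
    "E = card {j \<in> J. a j \<noteq> 0 \<and> b j \<noteq> 0}"
    using assms(5) by (auto simp: overlap_def supp_def intro!: arg_cong[where f = card])
  have "card J = card (?Z \<union> ({j \<in> J. a j \<noteq> 0 \<and> b j = 0} \<union> {j \<in> J. a j = 0 \<and> b j \<noteq> 0} \<union> {j \<in> J. a j \<noteq> 0 \<and> b j \<noteq> 0}))"
    by (intro arg_cong[where f = card]) auto
  also have "\<dots> = card ?Z + (A + B + E)"
    using assms(1) unfolding AB by (subst card_Un_disjoint; auto)+
  finally have J: "card J = card ?Z + (A + B + E)" .
  show "2 ^ (A + B + E) * card {X \<in> Pow J. sum a X \<in> {c, c + 1} \<and> sum b X \<in> {d, d + 1}} =
     2 ^ card J * layers2 A B E (c + card {j \<in> J. a j = -1}) (d + card {j \<in> J. b j = -1})"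
    unfolding card_pair[OF assms(1-4)] J AB[symmetric] by (simp add: power_add)
qed

text \<open>By \<open>card_mixed_signs_le\<close> the rows agree on their common support up to one
  global sign \<open>s\<close>. Multiplying \<open>b\<close> by \<open>s\<close> makes the pair a
  \<open>layers2\<close> count, and the list of alive patterns decides.\<close>

theorem pair_values:
  assumes "finite J" "signed_on J a" "signed_on J b" "2 \<le> card (supp J a)" "2 \<le> card (supp J b)"
    "\<exists>j\<in>J. a j \<noteq> b j" "2 ^ card J < 2 * card (sols J {a, b})"
  shows "overlap J a b \<in> star_types \<and> 8 * card (sols J {a, b}) = 5 * 2 ^ card J
    \<or> overlap J a b \<in> flat_types \<and> 16 * card (sols J {a, b}) = 9 * 2 ^ card J" (is ?thesis1)
    and "\<exists>s. (s = 1 \<or> s = -1) \<and> (\<forall>j\<in>J. a j \<noteq> 0 \<longrightarrow> b j \<noteq> 0 \<longrightarrow> b j = s * a j)" (is ?thesis2)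
proof -
  define s :: int where "s = (if \<forall>j\<in>J. a j \<noteq> 0 \<longrightarrow> b j \<noteq> 0 \<longrightarrow> b j = a j then 1 else -1)"
  have eq: "b j = a j \<or> b j = - a j" if "j \<in> J" "a j \<noteq> 0" "b j \<noteq> 0" for j
    using assms(2,3) that unfolding signed_on_def by force
  have s: "s = 1 \<or> s = -1" by (simp add: s_def)
  have ab: "b j = s * a j" if j: "j \<in> J" "a j \<noteq> 0" "b j \<noteq> 0" for j
  proof (cases "\<forall>j\<in>J. a j \<noteq> 0 \<longrightarrow> b j \<noteq> 0 \<longrightarrow> b j = a j")
    case True
    then show ?thesis using j by (simp add: s_def)
  next
    case False
    then obtain l where l: "l \<in> J" "a l \<noteq> 0" "b l = - a l" using eq by blast
    have "b j \<noteq> a j" using card_mixed_signs_le[OF assms(1-3), of j l] j l assms(7) by auto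
    then show ?thesis using eq[OF j] False by (simp add: s_def)
  qed
  then show ?thesis2 using s by blast
  define b' where "b' = (\<lambda>j. s * b j)"
  \<comment> \<open>Negating \<open>b\<close> turns the window {0, 1} into {-1, 0}, whose lower end
    is -1.\<close>
  define d :: int where "d = (if s = 1 then 0 else -1)"
  have sb: "signed_on J b'" using assms(3) s by (auto simp: signed_on_def b'_def)
  have ab': "\<forall>j\<in>J. a j \<noteq> 0 \<longrightarrow> b' j \<noteq> 0 \<longrightarrow> a j = b' j"
  proof (intro ballI impI)
    fix j assume "j \<in> J" "a j \<noteq> 0" "b' j \<noteq> 0"
    with ab[of j] s show "a j = b' j" by (auto simp: b'_def)
  qed
  have supp_b': "supp J b' = supp J b" using s by (auto simp: supp_def b'_def)
  have "sum b' X = s * sum b X" for X by (simp add: b'_def sum_distrib_left)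
  then have win: "sum b' X \<in> {d, d + 1} \<longleftrightarrow> sum b X \<in> {0, 1}" for X
    using s by (auto simp: d_def)
  have sols: "sols J {a, b} = {X \<in> Pow J. sum a X \<in> {0, 0 + 1} \<and> sum b' X \<in> {d, d + 1}}"
    unfolding win by (simp add: sols_def)
  obtain A B E where ABE: "overlap J a b = (A, B, E)" by (cases "overlap J a b") auto
  then have ov: "overlap J a b' = (A, B, E)" by (simp add: overlap_def supp_b')
  obtain c' d' where cd: "2 ^ (A + B + E) * card (sols J {a, b}) = 2 ^ card J * layers2 A B E c' d'"
    unfolding sols by (rule card_pair_supp[OF assms(1,2) sb ab' ov])
  note big = scale_less[OF cd assms(7)]
  then have "\<not> dead A B E" unfolding dead_def linorder_not_le[symmetric] by blast
  moreover note card_supp_overlap[OF assms(1) ABE]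
  moreover have "0 < A + B"
  proof (rule ccontr)
    assume "\<not> 0 < A + B"
    then have "supp J a = supp J b" using ABE assms(1) by (auto simp: overlap_def)
    then show False using card_same_supp_le[OF assms(1-3)] assms(6,7) unfolding linorder_not_le[symmetric] by blast
  qed
  ultimately have "(A, B, E) \<in> star_types \<union> flat_types"
    using alive_cases[of A B E] assms(4,5) unfolding star_types_def flat_types_def by simp
  then show ?thesis1
  proof
    assume t: "(A, B, E) \<in> star_types"
    from scale_eq[OF cd layers2_values[OF t[unfolded star_types_def] big]] t ABE show ?thesis1 by (simp only: simp_thms)
  next
    assume t: "(A, B, E) \<in> flat_types"
    from scale_eq[OF cd layers2_values'[OF t[unfolded flat_types_def] big]] t ABE show ?thesis1 by (simp only: simp_thms)
  qed
qed

section \<open>Systems without a star pair\<close>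

text \<open>Three pairwise independent events of probability \<open>3/4\<close>: inclusion-exclusion bounds the intersection by \<open>7/16\<close>.\<close>

lemma flat_triple_le:
  fixes S1 S2 S3 :: "'b set"
  assumes "finite U" "S1 \<subseteq> U" "S2 \<subseteq> U" "S3 \<subseteq> U"
    "4 * card S1 = 3 * card U" "4 * card S2 = 3 * card U" "4 * card S3 = 3 * card U"
    "16 * card (S1 \<inter> S2) = 9 * card U" "16 * card (S1 \<inter> S3) = 9 * card U" "16 * card (S2 \<inter> S3) = 9 * card U"
  shows "2 * card (S1 \<inter> S2 \<inter> S3) \<le> card U"
proof -
  have fin: "finite S1" "finite S2" "finite S3" using assms(1-4) by (auto intro: finite_subset)
  have "card S1 + card S2 = card (S1 \<union> S2) + card (S1 \<inter> S2)"
    by (rule card_Un_Int) (use fin in auto)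
  moreover have "card (S1 \<union> S2) + card S3 = card (S1 \<union> S2 \<union> S3) + card ((S1 \<union> S2) \<inter> S3)"
    by (rule card_Un_Int) (use fin in auto)
  moreover have "card (S1 \<inter> S3) + card (S2 \<inter> S3) = card ((S1 \<inter> S3) \<union> (S2 \<inter> S3)) + card ((S1 \<inter> S3) \<inter> (S2 \<inter> S3))"
    by (rule card_Un_Int) (use fin in auto)
  moreover have "(S1 \<inter> S3) \<union> (S2 \<inter> S3) = (S1 \<union> S2) \<inter> S3" "(S1 \<inter> S3) \<inter> (S2 \<inter> S3) = S1 \<inter> S2 \<inter> S3" by auto
  moreover have "card (S1 \<union> S2 \<union> S3) \<le> card U" by (rule card_mono) (use assms in auto)
  ultimately show ?thesis using assms(5-) by simp
qed

text \<open>Project along \<open>j\<close>: the union of the two slices satisfies \<open>c\<close> (at most \<open>3/4\<close>), and on their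
  intersection \<open>a\<close> and \<open>b\<close> are fixed (at most \<open>1/4\<close>).\<close>

lemma nested_triple_le:
  assumes "finite J" "signed_on J a" "signed_on J b" "signed_on J c"
    "i \<in> J" "a i \<noteq> 0" "b i = 0" "j \<in> J" "a j \<noteq> 0" "b j \<noteq> 0" "c j = 0" "l \<in> J" "l \<noteq> j" "b l \<noteq> 0" "2 \<le> card (supp J c)"
  shows "2 * card (sols J {a, b, c}) \<le> 2 ^ card J"
proof -
  let ?J = "J - {j}"
  define S0 where "S0 = {X \<in> Pow ?J. \<forall>r\<in>{a, b, c}. sum r X \<in> {0, 1}}"
  define S1 where "S1 = {X \<in> Pow ?J. \<forall>r\<in>{a, b, c}. sum r (insert j X) \<in> {0, 1}}"
  have fin: "finite S0" "finite S1" using assms(1) by (auto simp: S0_def S1_def)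
  have ins: "sum r (insert j X) = r j + sum r X" if "X \<subseteq> ?J" for r :: "'a \<Rightarrow> int" and X
    using sum_insert_subset[OF assms(1) that] .
  have cJ: "card J = Suc (card ?J)" using assms(1,8) by (metis card_Suc_Diff1)
  have "card (sols J {a, b, c}) = card S0 + card S1"
    unfolding sols_def S0_def S1_def by (rule card_Pow_remove[OF assms(1,8)])
  also have "\<dots> = card (S0 \<union> S1) + card (S0 \<inter> S1)" using fin by (rule card_Un_Int)
  finally have split: "card (sols J {a, b, c}) = card (S0 \<union> S1) + card (S0 \<inter> S1)" .
  have "card (S0 \<union> S1) \<le> card {X \<in> Pow ?J. sum c X \<in> {0, 0 + 1}}"
    by (rule card_mono) (use assms(1,11) ins in \<open>auto simp: S0_def S1_def\<close>)
  moreover have "supp ?J c = supp J c" using assms(11) by (auto simp: supp_def)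
  then have "4 * card {X \<in> Pow ?J. sum c X \<in> {0, 0 + 1}} \<le> 3 * 2 ^ card ?J"
    using assms(1,15) by (intro card_single_le signed_on_subset[OF assms(4)]) auto
  moreover
  have aj: "a j = 1 \<or> a j = -1" "b j = 1 \<or> b j = -1" using assms(2,3,8,9,10) by (auto simp: signed_on_def)
  \<comment> \<open>If both \<open>X\<close> and \<open>insert j X\<close> satisfy a row, its sum
    over \<open>X\<close> is 0 when the entry at \<open>j\<close> is 1, and 1 when that entry is
    -1.\<close>
  have "card (S0 \<inter> S1) \<le> card {X \<in> Pow ?J. sum a X = (if a j = 1 then 0 else 1) \<and> sum b X = (if b j = 1 then 0 else 1)}"
  proof (rule card_mono)
    show "S0 \<inter> S1 \<subseteq> {X \<in> Pow ?J. sum a X = (if a j = 1 then 0 else 1) \<and> sum b X = (if b j = 1 then 0 else 1)}"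
    proof
      fix X assume "X \<in> S0 \<inter> S1"
      then have X: "X \<subseteq> ?J" "sum a X \<in> {0, 1}" "a j + sum a X \<in> {0, 1}" "sum b X \<in> {0, 1}" "b j + sum b X \<in> {0, 1}"
        using ins[of X a] ins[of X b] by (simp_all add: S0_def S1_def)
      have "sum a X = (if a j = 1 then 0 else 1)" using aj(1) X(2,3) by auto
      moreover have "sum b X = (if b j = 1 then 0 else 1)" using aj(2) X(4,5) by auto
      ultimately show "X \<in> {X \<in> Pow ?J. sum a X = (if a j = 1 then 0 else 1) \<and> sum b X = (if b j = 1 then 0 else 1)}"
        using X(1) by simp
    qed
  qed (use assms(1) in simp)
  moreover have "4 * card {X \<in> Pow ?J. sum a X = (if a j = 1 then 0 else 1) \<and> sum b X = (if b j = 1 then 0 else 1)} \<le> 2 ^ card ?J"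
    using assms by (intro card_two_equations_le[of _ i l]) auto
  ultimately show ?thesis unfolding split cJ by simp
qed

text \<open>If all pairs are flat, at most one row has more than three entries and at most two have
  fewer than four. So there are exactly three rows, one large and two small, and
  \<open>nested_triple_le\<close> excludes them.\<close>

theorem star_pair_exists:
  assumes "finite J" "\<forall>r\<in>R. signed_on J r \<and> 2 \<le> card (supp J r)"
    "\<And>a b. a \<in> R \<Longrightarrow> b \<in> R \<Longrightarrow> a \<noteq> b \<Longrightarrow> \<exists>j\<in>J. a j \<noteq> b j"
    "3 \<le> card R" "2 ^ card J < 2 * card (sols J R)"
  shows "\<exists>a\<in>R. \<exists>b\<in>R. a \<noteq> b \<and> overlap J a b \<in> star_types"
proof (rule ccontr)
  assume no_star: "\<not> (\<exists>a\<in>R. \<exists>b\<in>R. a \<noteq> b \<and> overlap J a b \<in> star_types)"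
  have finR: "finite R" using assms(4) by (metis card.infinite not_numeral_le_zero)
  have big: "2 ^ card J < 2 * card (sols J T)" if "T \<subseteq> R" for T
    using card_sols_antimono[OF assms(1) that] assms(5) by linarith
  have flat: "overlap J a b \<in> flat_types" "16 * card (sols J {a, b}) = 9 * 2 ^ card J"
    if "a \<in> R" "b \<in> R" "a \<noteq> b" for a b
    using pair_values(1)[OF assms(1), of a b] assms(2) assms(3)[OF that] that big[of "{a, b}"] no_star by blast+
  have single: "card (supp J a) \<in> {2,3} \<and> 4 * card (sols J {a}) = 3 * 2 ^ card J \<or> card (supp J a) \<notin> {2,3}" if "a \<in> R" for a
    using card_single_values[OF assms(1), of a] assms(2) that big[of "{a}"] by auto
  define small where "small = {r \<in> R. card (supp J r) \<in> {2,3}}"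
  \<comment> \<open>No flat type has both supports of size at least 4.\<close>
  have big_unique: "a \<in> small \<or> b \<in> small" if "a \<in> R" "b \<in> R" "a \<noteq> b" for a b
  proof -
    obtain A B E where ov: "overlap J a b = (A, B, E)" by (cases "overlap J a b") auto
    then show ?thesis using flat(1)[OF that] card_supp_overlap[OF assms(1) ov] that(1,2)
      unfolding flat_types_def small_def by auto
  qed
  have "card (R - small) \<le> 1"
    by (rule card_le_Suc0_iff_eq[THEN iffD2, unfolded One_nat_def[symmetric]]) (use finR big_unique in auto)
  have no3: False if "a \<in> small" "b \<in> small" "c \<in> small" "a \<noteq> b" "a \<noteq> c" "b \<noteq> c" for a b c
  proof -
    have sub: "a \<in> R" "b \<in> R" "c \<in> R" using that by (auto simp: small_def)
    have c1: "4 * card (sols J {r}) = 3 * 2 ^ card J" if "r \<in> small" for r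
      using single[of r] that by (auto simp: small_def)
    have i: "sols J {x} \<inter> sols J {y} = sols J {x, y}" for x y by (auto simp: sols_def)
    have i3: "sols J {a, b} \<inter> sols J {c} = sols J {a, b, c}" by (auto simp: sols_def)
    have "2 * card (sols J {a} \<inter> sols J {b} \<inter> sols J {c}) \<le> card (Pow J)"
      by (rule flat_triple_le)
        (use assms(1) c1 flat(2) that sub in \<open>simp_all add: i card_Pow, auto simp: sols_def\<close>)
    then show False using big[of "{a, b, c}"] sub by (simp add: i i3 card_Pow assms(1))
  qed
  have "card small \<le> 2"
  proof (rule ccontr)
    assume "\<not> card small \<le> 2"
    then obtain T where "T \<subseteq> small" "card T = 3" using obtain_subset_with_card_n[of 3 small] by auto
    then obtain a b c where "T = {a, b, c}" "a \<noteq> b" "b \<noteq> c" "c \<noteq> a" by (auto simp: card_3_iff)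
    with no3[of a b c] \<open>T \<subseteq> small\<close> show False by auto
  qed
  moreover have "card R = card small + card (R - small)"
    using finR by (subst card_Un_disjoint[symmetric]) (auto simp: small_def intro!: arg_cong[where f = card])
  ultimately have "card small = 2" "card (R - small) = 1" using assms(4) \<open>card (R - small) \<le> 1\<close> by auto
  then obtain a b c where abc: "small = {b, c}" "b \<noteq> c" "R - small = {a}"
    by (auto simp: card_2_iff card_1_singleton_iff)
  then have mem: "a \<in> R" "b \<in> R" "c \<in> R" "a \<noteq> b" "a \<noteq> c" by (auto simp: small_def)
  have a_big: "card (supp J a) \<notin> {2,3}" and b_small: "card (supp J b) \<in> {2,3}" "card (supp J c) \<in> {2,3}"
    using abc mem by (auto simp: small_def)
  \<comment> \<open>A flat pair of a large and a small row is strictly nested, and in a flat pair of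
    small rows each has a private coordinate. This yields the coordinates \<open>i\<close>,
    \<open>j\<close>, \<open>l\<close> for \<open>nested_triple_le\<close>.\<close>
  obtain A B E where ab: "overlap J a b = (A, B, E)" by (cases "overlap J a b") auto
  have AB: "B = 0" "0 < A"
    using flat(1)[of a b] mem ab a_big b_small card_supp_overlap[OF assms(1) ab] unfolding flat_types_def by auto
  obtain A' B' E' where bc: "overlap J b c = (A', B', E')" by (cases "overlap J b c") auto
  have A': "0 < A'"
    using flat(1)[of b c] mem abc(2) bc b_small card_supp_overlap[OF assms(1) bc] unfolding flat_types_def by auto
  have "supp J b \<subseteq> supp J a" using AB(1) ab assms(1) by (auto simp: overlap_def)
  obtain i where i: "i \<in> J" "a i \<noteq> 0" "b i = 0"
    using AB(2) ab by (auto simp: overlap_def supp_def card_gt_0_iff)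
  obtain j where j: "j \<in> J" "b j \<noteq> 0" "c j = 0"
    using A' bc by (auto simp: overlap_def supp_def card_gt_0_iff)
  have "a j \<noteq> 0" using \<open>supp J b \<subseteq> supp J a\<close> j by (auto simp: supp_def)
  have "supp J b \<noteq> {j}" using b_small(1) by auto
  then obtain l where l: "l \<in> J" "l \<noteq> j" "b l \<noteq> 0" using j by (auto simp: supp_def)
  have "2 * card (sols J {a, b, c}) \<le> 2 ^ card J"
    by (rule nested_triple_le[OF assms(1), of a b c i j l])
      (use assms(2) mem i j l \<open>a j \<noteq> 0\<close> in auto)
  then show False using big[of "{a, b, c}"] mem by simp
qed

section \<open>Adding rows to a star\<close>

lemma sum_eq_supp:
  fixes r :: "'a \<Rightarrow> int"
  assumes "finite J" "X \<subseteq> J" "finite T" "supp J r \<subseteq> T"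
  shows "sum r X = (\<Sum>i\<in>T. if i \<in> X then r i else 0)"
proof -
  have "sum r X = sum r (T \<inter> X)"
    by (rule sum.mono_neutral_right) (use assms in \<open>auto simp: supp_def intro: finite_subset\<close>)
  then show ?thesis using assms(3) by (simp add: sum.inter_restrict)
qed

text \<open>On \<open>mid\<close> every row is satisfied for free; off \<open>mid\<close> the row \<open>r\<close> forces its private coordinate \<open>z\<close>.\<close>

lemma excess_halves:
  assumes "finite J" "z \<in> J" "\<forall>r\<in>R. r z = 0" "r \<notin> R"
    and mid_z: "\<And>X. mid (insert z X) \<longleftrightarrow> mid X"
    and mid_R: "\<And>X. X \<subseteq> J \<Longrightarrow> mid X \<Longrightarrow> \<forall>r\<in>R. sum r X \<in> {0, 1}"
    and mid_r: "\<And>X. X \<subseteq> J \<Longrightarrow> mid X \<Longrightarrow> sum r X \<in> {0, 1}"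
    and outer: "\<And>X. X \<subseteq> J - {z} \<Longrightarrow> \<not> mid X \<Longrightarrow> sum r (insert z X) \<in> {0, 1} \<longleftrightarrow> sum r X \<notin> {0, 1}"
    and half: "2 * card {X \<in> Pow J. mid X} = 2 ^ card J"
  shows "4 * card (sols J (insert r R)) = 2 * card (sols J R) + 2 ^ card J"
proof -
  let ?J = "J - {z}"
  define G where "G = {X \<in> Pow ?J. \<forall>r\<in>R. sum r X \<in> {0, 1}}"
  define S0 where "S0 = {X \<in> Pow ?J. \<forall>r\<in>insert r R. sum r X \<in> {0, 1}}"
  define S1 where "S1 = {X \<in> Pow ?J. \<forall>r\<in>insert r R. sum r (insert z X) \<in> {0, 1}}"
  have fin: "finite S0" "finite S1" using assms(1) by (auto simp: S0_def S1_def)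
  have Rz: "(\<forall>r\<in>R. sum r (insert z X) \<in> {0, 1}) \<longleftrightarrow> (\<forall>r\<in>R. sum r X \<in> {0, 1})" if "X \<in> Pow ?J" for X
  proof -
    have "sum r (insert z X) = sum r X" if "r \<in> R" for r
      using \<open>X \<in> Pow ?J\<close> that assms(3) sum_insert_subset[OF assms(1), of X z r] by simp
    then show ?thesis by simp
  qed
  have "{X \<in> Pow ?J. \<forall>r\<in>R. sum r (insert z X) \<in> {0, 1}} = G"
    unfolding G_def using Rz by (intro Collect_cong conj_cong refl)
  then have G: "card (sols J R) = card G + card G"
    unfolding sols_def by (subst card_Pow_remove[OF assms(1,2)]) (simp only: G_def[symmetric])
  have M: "card {X \<in> Pow J. mid X} = card {X \<in> Pow ?J. mid X} + card {X \<in> Pow ?J. mid X}"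
    by (subst card_Pow_remove[OF assms(1,2)]) (simp only: mid_z)
  have "card (sols J (insert r R)) = card S0 + card S1"
    unfolding sols_def S0_def S1_def by (rule card_Pow_remove[OF assms(1,2)])
  also have "\<dots> = card (S0 \<union> S1) + card (S0 \<inter> S1)" using fin by (rule card_Un_Int)
  \<comment> \<open>Given \<open>R\<close>, each edge in direction \<open>z\<close> has both
    endpoints good for \<open>r\<close> inside \<open>mid\<close> and exactly one outside: the union
    of the slices is all of \<open>G\<close>, their intersection is \<open>mid\<close>.\<close>
  also have "S0 \<union> S1 = G"
  proof
    show "S0 \<union> S1 \<subseteq> G" unfolding S0_def S1_def G_def using Rz by blast
    show "G \<subseteq> S0 \<union> S1"
    proof
      fix X assume X: "X \<in> G"
      then have sub: "X \<subseteq> ?J" "X \<subseteq> J" by (auto simp: G_def)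
      then have "sum r X \<in> {0, 1} \<or> sum r (insert z X) \<in> {0, 1}"
        using mid_r[of X] outer[of X] by blast
      then show "X \<in> S0 \<union> S1" using X Rz[of X] unfolding S0_def S1_def G_def by blast
    qed
  qed
  also have "S0 \<inter> S1 = {X \<in> Pow ?J. mid X}"
  proof
    show "S0 \<inter> S1 \<subseteq> {X \<in> Pow ?J. mid X}"
      using outer unfolding S0_def S1_def by blast
    show "{X \<in> Pow ?J. mid X} \<subseteq> S0 \<inter> S1"
    proof
      fix X assume "X \<in> {X \<in> Pow ?J. mid X}"
      then have X: "X \<subseteq> ?J" "mid X" "mid (insert z X)" "X \<subseteq> J" "insert z X \<subseteq> J" using mid_z assms(2) by auto
      then show "X \<in> S0 \<inter> S1"
        using mid_R[of X] mid_r[of X] mid_R[of "insert z X"] mid_r[of "insert z X"] unfolding S0_def S1_def by blast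
    qed
  qed
  finally show ?thesis using G M half by simp
qed

text \<open>Iterates \<open>excess_halves\<close>: adding a row of \<open>Q\<close> halves twice the
  number of solutions minus \<open>2 ^ card J\<close>. The equation is additive to avoid truncated
  subtraction. \<open>R\<close> is the base system, in the applications with at most one
  row.\<close>

lemma star_count:
  assumes "finite J" "finite Q" "Q \<inter> R = {}"
    and z: "\<And>q. q \<in> Q \<Longrightarrow> z q \<in> J" "\<And>q r. q \<in> Q \<Longrightarrow> r \<in> R \<union> Q \<Longrightarrow> r \<noteq> q \<Longrightarrow> r (z q) = 0"
    and mid_z: "\<And>q X. q \<in> Q \<Longrightarrow> mid (insert (z q) X) \<longleftrightarrow> mid X"
    and mid: "\<And>r X. r \<in> R \<union> Q \<Longrightarrow> X \<subseteq> J \<Longrightarrow> mid X \<Longrightarrow> sum r X \<in> {0, 1}"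
    and outer: "\<And>q X. q \<in> Q \<Longrightarrow> X \<subseteq> J - {z q} \<Longrightarrow> \<not> mid X \<Longrightarrow>
       sum q (insert (z q) X) \<in> {0, 1} \<longleftrightarrow> sum q X \<notin> {0, 1}"
    and half: "2 * card {X \<in> Pow J. mid X} = 2 ^ card J"
  shows "2 ^ card Q * (2 * card (sols J (R \<union> Q))) + 2 ^ card J = 2 ^ card Q * 2 ^ card J + 2 * card (sols J R)"
proof -
  have "P \<subseteq> Q \<Longrightarrow>
    2 ^ card P * (2 * card (sols J (R \<union> P))) + 2 ^ card J = 2 ^ card P * 2 ^ card J + 2 * card (sols J R)"
    if "finite P" for P
    using that
  proof (induction P rule: finite_induct)
    case (insert q P)
    have q: "q \<in> Q" "P \<subseteq> Q" using insert.prems by auto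
    have "4 * card (sols J (insert q (R \<union> P))) = 2 * card (sols J (R \<union> P)) + 2 ^ card J"
    proof (rule excess_halves[of J "z q" "R \<union> P" q mid, OF assms(1) _ _ _ _ _ _ _ half])
      show "\<forall>r\<in>R \<union> P. r (z q) = 0" using z(2)[OF q(1)] q(2) insert.hyps(2) assms(3) q(1) by blast
      show "\<forall>r\<in>R \<union> P. sum r X \<in> {0, 1}" if "X \<subseteq> J" "mid X" for X using mid that q(2) by blast
    qed (use q z(1) mid_z mid outer insert.hyps(2) assms(3) in blast)+
    moreover have "2 ^ card P * (2 * card (sols J (R \<union> P))) + 2 ^ card J = 2 ^ card P * 2 ^ card J + 2 * card (sols J R)"
      using insert.IH[OF q(2)] .
    ultimately have "2 ^ card P * (4 * card (sols J (insert q (R \<union> P)))) + 2 ^ card J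
        = 2 * (2 ^ card P * 2 ^ card J) + 2 * card (sols J R)"
      by (simp only: distrib_left)
    then show ?case using insert.hyps by simp
  qed simp
  from this[OF assms(2) order_refl] show ?thesis .
qed

text \<open>Outside \<open>mid\<close> the pair leaves only 5/8 - 1/2 = 1/8 of the cube. So more
  than 3/8 of the cube, which is 3/4 of \<open>mid\<close>, must come from inside.\<close>

lemma mid_dominates:
  assumes "finite J" "a \<in> R" "b \<in> R" "8 * card (sols J {a, b}) = 5 * 2 ^ card J"
    and half: "2 * card {X \<in> Pow J. mid X} = 2 ^ card J"
    and mid: "\<And>X. X \<subseteq> J \<Longrightarrow> mid X \<Longrightarrow> X \<in> sols J {a, b}"
    and "2 ^ card J < 2 * card (sols J R)"
  shows "3 * 2 ^ card J < 8 * card {X \<in> Pow J. mid X \<and> (\<forall>r\<in>R. sum r X \<in> {0, 1})}"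
proof -
  let ?M = "{X \<in> Pow J. mid X}"
  have "card (sols J R) \<le> card ({X \<in> Pow J. mid X \<and> (\<forall>r\<in>R. sum r X \<in> {0, 1})} \<union> (sols J {a, b} - ?M))"
    by (rule card_mono) (use assms(1-3) in \<open>auto simp: sols_def\<close>)
  also have "\<dots> \<le> card {X \<in> Pow J. mid X \<and> (\<forall>r\<in>R. sum r X \<in> {0, 1})} + card (sols J {a, b} - ?M)"
    by (rule card_Un_le)
  also have "card (sols J {a, b} - ?M) = card (sols J {a, b}) - card ?M"
    by (rule card_Diff_subset) (use assms(1) mid in auto)
  finally show ?thesis using assms(4,7) half by linarith
qed

lemma sum_slice:
  fixes r :: "'a \<Rightarrow> int"
  assumes "finite J" "B \<subseteq> J" "Y \<subseteq> B" "X \<subseteq> J - B"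
  shows "sum r (Y \<union> X) = sum r Y + sum r X"
  using assms by (intro sum.union_disjoint) (auto intro: finite_subset)

lemma slice_Collect:
  fixes r :: "'a \<Rightarrow> int"
  assumes "finite J" "B \<subseteq> J" "Y \<subseteq> B"
  shows "{X \<in> Pow (J - B). sum r (Y \<union> X) \<in> {0, 1}} = {X \<in> Pow (J - B). sum r X \<in> {- sum r Y, - sum r Y + 1}}"
proof (intro Collect_cong conj_cong refl)
  fix X assume "X \<in> Pow (J - B)"
  then show "sum r (Y \<union> X) \<in> {0, 1} \<longleftrightarrow> sum r X \<in> {- sum r Y, - sum r Y + 1}"
    using sum_slice[OF assms, of X r] by auto
qed

text \<open>Fixing the coordinates in \<open>B\<close> only shifts the window of \<open>r\<close>,
  so \<open>card_single_dichotomy\<close> applies on the slice.\<close>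

lemma slice_full:
  assumes "finite J" "B \<subseteq> J" "Y \<subseteq> B" "signed_on J r"
    "3 * 2 ^ card (J - B) < 4 * card {X \<in> Pow (J - B). \<forall>r\<in>R. sum r (Y \<union> X) \<in> {0, 1}}" "r \<in> R"
  shows "card (supp (J - B) r) \<le> 1" "X \<subseteq> J - B \<Longrightarrow> sum r (Y \<union> X) \<in> {0, 1}"
proof -
  have "card {X \<in> Pow (J - B). \<forall>r\<in>R. sum r (Y \<union> X) \<in> {0, 1}} \<le> card {X \<in> Pow (J - B). sum r (Y \<union> X) \<in> {0, 1}}"
    using assms(1,6) by (intro card_Pow_mono) auto
  then have "\<not> 4 * card {X \<in> Pow (J - B). sum r X \<in> {- sum r Y, - sum r Y + 1}} \<le> 3 * 2 ^ card (J - B)"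
    using assms(5) unfolding slice_Collect[OF assms(1-3)] by linarith
  then have *: "card (supp (J - B) r) \<le> 1 \<and> (\<forall>X\<subseteq>J - B. sum r X \<in> {- sum r Y, - sum r Y + 1})"
    using card_single_dichotomy[OF finite_Diff[OF assms(1)] signed_on_subset[OF assms(4) Diff_subset], of B "- sum r Y"]
    by blast
  then show "card (supp (J - B) r) \<le> 1" by blast
  show "sum r (Y \<union> X) \<in> {0, 1}" if "X \<subseteq> J - B"
  proof -
    from * that have "sum r X \<in> {- sum r Y, - sum r Y + 1}" by blast
    then show ?thesis unfolding sum_slice[OF assms(1-3) that] by auto
  qed
qed

text \<open>Once a row has at most one entry off \<open>B\<close>, the threshold 1/2 replaces 3/4.
  This serves slices for which 3/4 is not, or not yet, available.\<close>

lemma slice_full_half: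
  assumes "finite J" "B \<subseteq> J" "Y \<subseteq> B" "signed_on J r" "card (supp (J - B) r) \<le> 1"
    "2 ^ card (J - B) < 2 * card {X \<in> Pow (J - B). \<forall>r\<in>R. sum r (Y \<union> X) \<in> {0, 1}}" "r \<in> R" "X \<subseteq> J - B"
  shows "sum r (Y \<union> X) \<in> {0, 1}"
proof -
  have "card {X \<in> Pow (J - B). \<forall>r\<in>R. sum r (Y \<union> X) \<in> {0, 1}} \<le> card {X \<in> Pow (J - B). sum r (Y \<union> X) \<in> {0, 1}}"
    using assms(1,7) by (intro card_Pow_mono) auto
  then have "\<not> 2 * card {X \<in> Pow (J - B). sum r X \<in> {- sum r Y, - sum r Y + 1}} \<le> 2 ^ card (J - B)"
    using assms(6) unfolding slice_Collect[OF assms(1-3)] by linarith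
  then have *: "\<forall>X\<subseteq>J - B. sum r X \<in> {- sum r Y, - sum r Y + 1}"
    using card_single_small_supp[OF finite_Diff[OF assms(1)] signed_on_subset[OF assms(4) Diff_subset] assms(5), of "- sum r Y"]
    by blast
  then have "sum r X \<in> {- sum r Y, - sum r Y + 1}" using assms(8) by blast
  then show ?thesis unfolding sum_slice[OF assms(1-3,8)] by auto
qed

text \<open>Ensures that the private coordinates of different star rows are different.\<close>

lemma supp_neq:
  assumes "finite J" "\<forall>r\<in>R. signed_on J r" "2 ^ card J < 2 * card (sols J R)" "r \<in> R" "q \<in> R" "\<exists>j\<in>J. r j \<noteq> q j"
  shows "supp J r \<noteq> supp J q"
proof
  assume "supp J r = supp J q"
  then have "2 * card (sols J {r, q}) \<le> 2 ^ card J"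
    using card_same_supp_le[OF assms(1), of r q] assms(2,4-6) by blast
  moreover have "card (sols J R) \<le> card (sols J {r, q})"
    using assms(1,4,5) by (intro card_sols_antimono) auto
  ultimately show False using assms(3) by linarith
qed

section \<open>Systems containing a star pair\<close>

lemma card_slice:
  assumes "B \<subseteq> J" "Y \<subseteq> B"
  shows "card {X \<in> Pow J. X \<inter> B = Y \<and> P X} = card {X \<in> Pow (J - B). P (Y \<union> X)}"
proof -
  have "{X \<in> Pow J. X \<inter> B = Y \<and> P X} = (\<union>) Y ` {X \<in> Pow (J - B). P (Y \<union> X)}"
  proof (intro equalityI subsetI)
    fix X assume X: "X \<in> {X \<in> Pow J. X \<inter> B = Y \<and> P X}"
    then have eq: "Y \<union> (X - B) = X" by auto
    show "X \<in> (\<union>) Y ` {X \<in> Pow (J - B). P (Y \<union> X)}"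
      by (rule image_eqI[where x = "X - B"]) (use X eq in auto)
  qed (use assms in auto)
  moreover have "inj_on ((\<union>) Y) {X \<in> Pow (J - B). P (Y \<union> X)}"
    using assms by (intro inj_onI) blast
  ultimately show ?thesis by (simp add: card_image)
qed

lemma card_slice_all:
  assumes "finite J" "B \<subseteq> J" "Y \<subseteq> B"
  shows "card {X \<in> Pow J. X \<inter> B = Y} = 2 ^ card (J - B)"
  using card_slice[OF assms(2,3), of "\<lambda>_. True"] assms(1) by (simp add: card_Pow Pow_def[symmetric])

text \<open>Here \<open>mid\<close> is the slice \<open>x\<^sub>j = 0\<close> or \<open>x\<^sub>j = 1\<close> through the common coordinate \<open>j\<close> of \<open>a\<close> and \<open>b\<close>.\<close>

lemma star_count_edges:
  assumes fin: "finite J" "finite R"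
    and rows: "\<forall>r\<in>R. signed_on J r \<and> 2 \<le> card (supp J r)"
    and neq: "\<And>a b. a \<in> R \<Longrightarrow> b \<in> R \<Longrightarrow> a \<noteq> b \<Longrightarrow> \<exists>j\<in>J. a j \<noteq> b j"
    and ab: "a \<in> R" "b \<in> R" "a \<noteq> b" "overlap J a b = (1, 1, 1)"
    and big: "2 ^ card J < 2 * card (sols J R)"
  shows "2 ^ card R * (2 * card (sols J R)) = 2 ^ card R * 2 ^ card J + 2 ^ card J" "card R < card J"
proof -
  obtain j p q where jpq: "supp J a \<inter> supp J b = {j}" "supp J a - supp J b = {p}" "supp J b - supp J a = {q}"
    using ab(4) by (auto simp: overlap_def card_1_singleton_iff)
  then have "supp J a = {j, p}" "supp J b = {j, q}" and ne: "p \<noteq> j" "q \<noteq> j" "p \<noteq> q" by auto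
  then have sup: "{i \<in> J. a i \<noteq> 0} = {j, p}" "{i \<in> J. b i \<noteq> 0} = {j, q}" by (simp_all add: supp_def)
  then have jJ: "j \<in> J" by blast
  let ?J = "J - {j}"
  have BJ: "{j} \<subseteq> J" using jJ by simp
  have cJ: "card J = Suc (card ?J)" using fin(1) jJ by (metis card_Suc_Diff1)
  define D where "D Y = card {X \<in> Pow ?J. \<forall>r\<in>R. sum r (Y \<union> X) \<in> {0, 1}}" for Y
  have "card (sols J R) = D {} + D {j}"
    unfolding sols_def D_def by (subst card_Pow_remove[OF fin(1) jJ]) simp
  then have "2 ^ card ?J < 2 * D {} \<or> 2 ^ card ?J < 2 * D {j}"
    using big unfolding cJ power_Suc by linarith
  \<comment> \<open>A slice more than half full makes \<open>a\<close> and \<open>b\<close> trivial,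
    as each has one entry off \<open>j\<close>; this selects the value of coordinate
    \<open>j\<close> that defines \<open>mid\<close>.\<close>
  then obtain Y where Y: "Y = {} \<or> Y = {j}" "2 ^ card ?J < 2 * D Y" by blast
  then have YB: "Y \<subseteq> {j}" by auto
  have "supp ?J a = {p}" "supp ?J b = {q}" using sup ne by (auto simp: supp_def)
  then have s1: "card (supp ?J a) \<le> 1" "card (supp ?J b) \<le> 1" by simp_all
  have full_ab: "sum r (Y \<union> X) \<in> {0, 1}" if "r \<in> {a, b}" "X \<subseteq> ?J" for r X
    using slice_full_half[OF fin(1) BJ YB, of r R X] that s1 rows ab(1,2) Y(2) unfolding D_def by blast
  define mid where "mid X \<longleftrightarrow> X \<inter> {j} = Y" for X
  have mid_eq: "X = Y \<union> (X - {j})" "X - {j} \<subseteq> ?J" if "X \<subseteq> J" "mid X" for X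
    using that Y(1) by (auto simp: mid_def)
  have half: "2 * card {X \<in> Pow J. mid X} = 2 ^ card J"
    unfolding mid_def card_slice_all[OF fin(1) BJ YB] cJ by simp
  have "2 ^ card J < 2 * card (sols J {a, b})"
    using card_sols_antimono[OF fin(1), of "{a, b}" R] ab(1,2) big by auto
  then have "8 * card (sols J {a, b}) = 5 * 2 ^ card J"
    using pair_values(1)[OF fin(1), of a b] rows ab neq[of a b] by (auto simp: flat_types_def)
  moreover have "X \<in> sols J {a, b}" if "X \<subseteq> J" "mid X" for X
    using full_ab[of _ "X - {j}"] mid_eq[OF that] that(1) unfolding sols_def by auto
  ultimately have "3 * 2 ^ card J < 8 * card {X \<in> Pow J. mid X \<and> (\<forall>r\<in>R. sum r X \<in> {0, 1})}"
    using mid_dominates[OF fin(1) ab(1,2) _ half _ big] by blast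
  also have "card {X \<in> Pow J. mid X \<and> (\<forall>r\<in>R. sum r X \<in> {0, 1})} = D Y"
    unfolding mid_def D_def by (rule card_slice[OF BJ YB])
  finally have "3 * 2 ^ card ?J < 4 * D Y" unfolding cJ by simp
  note DY = this[unfolded D_def]
  have full: "sum r (Y \<union> X) \<in> {0, 1}" if "r \<in> R" "X \<subseteq> ?J" for r X
    using slice_full(2)[OF fin(1) BJ YB _ DY] rows that by blast
  have "\<exists>z. supp J r = {j, z} \<and> z \<noteq> j" if "r \<in> R" for r
  proof -
    have "card (supp ?J r) \<le> 1" using slice_full(1)[OF fin(1) BJ YB _ DY] rows that by blast
    moreover have eq: "supp J r = (if r j = 0 then {} else {j}) \<union> supp ?J r" using jJ by (auto simp: supp_def)
    then have "card (supp J r) \<le> (if r j = 0 then 0 else 1) + card (supp ?J r)"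
      using fin(1) by (simp add: card_insert_if)
    moreover have "2 \<le> card (supp J r)" using rows that by blast
    ultimately have "r j \<noteq> 0" "card (supp ?J r) = 1" by (auto split: if_splits)
    then obtain z where "supp ?J r = {z}" by (auto simp: card_1_singleton_iff)
    with eq \<open>r j \<noteq> 0\<close> have "supp J r = {j, z}" "z \<noteq> j" by (auto simp: supp_def)
    then show ?thesis by blast
  qed
  then obtain z where z: "\<And>r. r \<in> R \<Longrightarrow> supp J r = {j, z r}" "\<And>r. r \<in> R \<Longrightarrow> z r \<noteq> j" by metis
  have zJ: "z r \<in> J" "r (z r) \<noteq> 0" "r j \<noteq> 0" if "r \<in> R" for r
    using z(1)[OF that] unfolding supp_def by blast+
  have z_ne: "z r \<noteq> z q" if "r \<in> R" "q \<in> R" "r \<noteq> q" for r q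
    using supp_neq[OF fin(1) _ big that(1,2) neq[OF that]] rows z(1)[OF that(1)] z(1)[OF that(2)] by auto
  have sum_z: "sum r X = (if j \<in> X then r j else 0) + (if z r \<in> X then r (z r) else 0)" if "r \<in> R" "X \<subseteq> J" for r X
    using sum_eq_supp[OF fin(1) that(2), of "{j, z r}" r] z[OF that(1)] by simp
  have val: "r j = 1 \<or> r j = -1" "r (z r) = 1 \<or> r (z r) = -1" if "r \<in> R" for r
    using rows that zJ[OF that] jJ by (auto simp: signed_on_def)
  have "2 ^ card R * (2 * card (sols J ({} \<union> R))) + 2 ^ card J = 2 ^ card R * 2 ^ card J + 2 * card (sols J {})"
  proof (rule star_count[where z = z and mid = mid, OF fin, of "{}"])
    show "r (z q) = 0" if "q \<in> R" "r \<in> {} \<union> R" "r \<noteq> q" for q r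
    proof -
      have "z q \<notin> supp J r" using z[of r] z_ne[of r q] z(2)[of q] that by auto
      then show ?thesis using zJ(1)[OF that(1)] by (simp add: supp_def)
    qed
    show "mid (insert (z q) X) \<longleftrightarrow> mid X" if "q \<in> R" for q X
      using z(2)[OF that] by (simp add: mid_def)
    show "sum r X \<in> {0, 1}" if "r \<in> {} \<union> R" "X \<subseteq> J" "mid X" for r X
      using full[of r "X - {j}"] mid_eq[OF that(2,3)] that(1) by simp
    \<comment> \<open>On \<open>mid\<close> the two choices at \<open>z q\<close> give the sums 0
      and 1. Changing coordinate \<open>j\<close> shifts both by the same 1 or -1, so exactly one
      stays in the window.\<close>
    show "sum q (insert (z q) X) \<in> {0, 1} \<longleftrightarrow> sum q X \<notin> {0, 1}" if "q \<in> R" "X \<subseteq> J - {z q}" "\<not> mid X" for q X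
    proof -
      have X: "insert (z q) X \<subseteq> J" "X \<subseteq> J" "z q \<notin> X" "j \<in> insert (z q) X \<longleftrightarrow> j \<in> X"
        using that(2) zJ(1)[OF that(1)] z(2)[OF that(1)] by auto
      have c: "z q \<in> J" "z q \<noteq> j" using zJ(1) z(2) that(1) by auto
      from full[OF that(1), of "{z q}"] full[OF that(1), of "{}"]
      have "(if j \<in> Y then q j else 0) + q (z q) \<in> {0, 1}" "(if j \<in> Y then q j else 0) \<in> {0, 1}"
        using sum_z[OF that(1), of "Y \<union> {z q}"] sum_z[OF that(1), of "Y"] Y(1) c jJ by auto
      moreover have "j \<in> X \<longleftrightarrow> j \<notin> Y" using that(3) Y(1) by (auto simp: mid_def)
      ultimately show ?thesis
        unfolding sum_z[OF that(1) X(1)] sum_z[OF that(1) X(2)] X(4)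
        using val[OF that(1)] X(3) by (cases "j \<in> X") auto
    qed
  qed (use zJ half in auto)
  moreover have "card (sols J {}) = 2 ^ card J" using fin(1) by (simp add: sols_def card_Pow Pow_def[symmetric])
  ultimately show "2 ^ card R * (2 * card (sols J R)) = 2 ^ card R * 2 ^ card J + 2 ^ card J" by simp
  have "card R \<le> card ?J"
  proof (rule card_inj_on_le[of z])
    show "inj_on z R" using z_ne by (auto intro: inj_onI)
    show "z ` R \<subseteq> ?J" using zJ(1) z(2) by auto
  qed (use fin in auto)
  then show "card R < card J" using cJ by simp
qed

text \<open>With \<open>m\<close> negative entries the densities are those of
  \<open>3 choose m + 1\<close> in 4 and \<open>4 choose m + 1\<close> in 8. In particular a row
  with three entries has the form x + y - z.\<close>

lemma card_neg_entries:
  assumes "finite J" "signed_on J r" "2 ^ card J < 2 * card (sols J {r})"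
  shows "card (supp J r) = 2 \<Longrightarrow> card {j \<in> J. r j = -1} \<le> 1"
    and "card (supp J r) = 3 \<Longrightarrow> card {j \<in> J. r j = -1} = 1"
proof -
  let ?n = "card (supp J r)" and ?m = "card {j \<in> J. r j = -1}"
  have le: "?m \<le> ?n" by (rule card_mono) (use assms(1) in \<open>auto simp: supp_def\<close>)
  have "sols J {r} = {X \<in> Pow J. sum r X \<in> {0, 0 + 1}}" by (simp add: sols_def)
  then have "card (sols J {r}) = 2 ^ card {j \<in> J. r j = 0} * layers ?n (0 + int ?m)"
    by (simp only: card_single[OF assms(1,2)])
  then have "2 ^ ?n * card (sols J {r}) = 2 ^ card J * layers ?n (0 + int ?m)"
    unfolding card_zeros_supp[OF assms(1), of r, symmetric] by (simp add: power_add)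
  from scale_less[OF this assms(3)] have big: "2 ^ ?n < 2 * layers ?n (int ?m)" by simp
  show "?m \<le> 1" if "?n = 2"
  proof (rule ccontr)
    assume "\<not> ?m \<le> 1"
    with le that have "?m = 2" by simp
    with big that show False by (simp add: layers_g_numeral)
  qed
  show "?m = 1" if "?n = 3"
  proof (rule ccontr)
    assume "?m \<noteq> 1"
    with le that have "?m = 0 \<or> ?m = 2 \<or> ?m = 3" by arith
    with big that show False by (elim disjE) (simp_all add: layers_g_numeral)
  qed
qed

lemma card_Collect_two:
  assumes "x \<noteq> y"
  shows "card {j \<in> {x, y}. P j} = of_bool (P x) + of_bool (P y)"
proof -
  have "{j \<in> {x, y}. P j} = (if P x then {x} else {}) \<union> (if P y then {y} else {})" by auto
  then show ?thesis using assms by auto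
qed

lemma card_Collect_three:
  assumes "x \<noteq> y" "x \<noteq> z" "y \<noteq> z"
  shows "card {j \<in> {x, y, z}. P j} = of_bool (P x) + of_bool (P y) + of_bool (P z)"
proof -
  have "{j \<in> {x, y, z}. P j} = (if P x then {x} else {}) \<union> (if P y then {y} else {}) \<union> (if P z then {z} else {})" by auto
  then show ?thesis using assms by auto
qed

text \<open>Under the last hypothesis \<open>x\<close> and \<open>y\<close> contribute a constant:
  \<open>r x\<close> for equal entries, 0 for opposite ones. By \<open>card_neg_entries\<close>
  equal entries are 1 unless a third entry is missing or negative in a way that still forces 1; a
  third entry is -1 after the constant 1 and 1 after the constant 0, so the sum stays in the
  window.\<close>

lemma plane_row_mid:
  assumes "finite J" "signed_on J r" "2 ^ card J < 2 * card (sols J {r})"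
    "x \<noteq> y" "supp J r = {x, y} \<union> Z" "Z \<inter> {x, y} = {}" "card Z \<le> 1"
    "X \<subseteq> J" "((x \<in> X) = (y \<in> X)) \<noteq> (r x = r y)"
  shows "sum r X \<in> {0, 1}"
proof -
  have finZ: "finite Z" using assms(1,5) finite_supp[of J r] by simp
  have neg: "{j \<in> J. r j = -1} = {j \<in> supp J r. r j = -1}" by (auto simp: supp_def)
  have val: "r j = 1 \<or> r j = -1" if "j \<in> supp J r" for j
    using assms(2) that by (auto simp: supp_def signed_on_def)
  have xy: "r x = 1 \<or> r x = -1" "r y = 1 \<or> r y = -1" using val[of x] val[of y] assms(5) by auto
  consider "Z = {}" | z where "Z = {z}"
    using assms(7) finZ by (auto simp: le_Suc_eq card_1_singleton_iff)
  then show ?thesis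
  proof cases
    case 1
    then have s: "supp J r = {x, y}" using assms(5) by simp
    have "card {j \<in> {x, y}. r j = -1} \<le> 1"
      using card_neg_entries(1)[OF assms(1-3)] assms(4) unfolding neg s by simp
    then have "r x = 1 \<or> r y = 1"
      using xy unfolding card_Collect_two[OF assms(4)] by auto
    then show ?thesis
      using sum_eq_supp[OF assms(1,8), of "{x, y}" r] s assms(4,9) xy by auto
  next
    case 2
    then have s: "supp J r = {x, y, z}" and z: "z \<noteq> x" "z \<noteq> y" using assms(5,6) by auto
    have rz: "r z = 1 \<or> r z = -1" using val[of z] s by auto
    have "card {j \<in> {x, y, z}. r j = -1} = 1"
      using card_neg_entries(2)[OF assms(1-3)] assms(4) z unfolding neg s by simp
    then have "r x = 1 \<and> r y = 1 \<and> r z = -1 \<or> r x = -1 \<and> r y = 1 \<and> r z = 1 \<or> r x = 1 \<and> r y = -1 \<and> r z = 1"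
      using xy rz unfolding card_Collect_three[OF assms(4) z(1)[symmetric] z(2)[symmetric]] by auto
    moreover have "sum r X = (if x \<in> X then r x else 0) + (if y \<in> X then r y else 0) + (if z \<in> X then r z else 0)"
      using sum_eq_supp[OF assms(1,8), of "{x, y, z}" r] s assms(4) z by simp
    ultimately show ?thesis using assms(9)
      by (cases "x \<in> X"; cases "y \<in> X"; cases "z \<in> X") auto
  qed
qed

text \<open>Here \<open>mid\<close> is the hyperplane \<open>x + y = 1\<close> or \<open>x = y\<close>, depending on the relative sign of the two entries
  of \<open>a\<close> (equivalently \<open>b\<close>) on the common coordinates \<open>x, y\<close>.\<close>

lemma star_count_planes:
  assumes fin: "finite J" "finite R"
    and rows: "\<forall>r\<in>R. signed_on J r \<and> 2 \<le> card (supp J r)"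
    and neq: "\<And>a b. a \<in> R \<Longrightarrow> b \<in> R \<Longrightarrow> a \<noteq> b \<Longrightarrow> \<exists>j\<in>J. a j \<noteq> b j"
    and ab: "a \<in> R" "b \<in> R" "a \<noteq> b" "overlap J a b \<in> {(1, 0, 2), (0, 1, 2), (1, 1, 2)}"
    and big: "2 ^ card J < 2 * card (sols J R)"
  shows "2 ^ card R * (2 * card (sols J R)) = 2 ^ card R * 2 ^ card J + 2 ^ card J" "card R < card J"
proof -
  have bigT: "2 ^ card J < 2 * card (sols J T)" if "T \<subseteq> R" for T
    using card_sols_antimono[OF fin(1) that] big by linarith
  obtain x y where xy: "supp J a \<inter> supp J b = {x, y}" "x \<noteq> y"
    using ab(4) by (auto simp: overlap_def card_2_iff)
  then have xyJ: "x \<in> J" "y \<in> J" and xy0: "a x \<noteq> 0" "b x \<noteq> 0" "a y \<noteq> 0" "b y \<noteq> 0"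
    unfolding supp_def by blast+
  have Z: "card (supp J a - supp J b) \<le> 1" "card (supp J b - supp J a) \<le> 1"
    using ab(4) by (auto simp: overlap_def)
  let ?B = "{x, y}"
  let ?J = "J - ?B"
  have BJ: "?B \<subseteq> J" using xyJ by simp
  have cJ: "card J = Suc (Suc (card ?J))"
    using card_Diff_subset[OF _ BJ] card_mono[OF fin(1) BJ] xy(2) by simp
  obtain s where s: "s = 1 \<or> s = (-1::int)" "\<forall>j\<in>J. a j \<noteq> 0 \<longrightarrow> b j \<noteq> 0 \<longrightarrow> b j = s * a j"
    using pair_values(2)[OF fin(1), of a b] rows ab(1-3) neq[of a b] bigT[of "{a, b}"] by blast
  then have "b x = s * a x" "b y = s * a y" using xyJ xy0 by blast+
  then have \<tau>b: "b x = b y \<longleftrightarrow> a x = a y" using s(1) by auto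
  define mid where "mid X \<longleftrightarrow> ((x \<in> X) = (y \<in> X)) \<noteq> (a x = a y)" for X
  define Y1 where "Y1 = (if a x = a y then {x} else {})"
  define Y2 where "Y2 = (if a x = a y then {y} else {x, y})"
  have Y: "Y1 \<subseteq> ?B" "Y2 \<subseteq> ?B" "Y1 \<noteq> Y2" using xy(2) by (auto simp: Y1_def Y2_def)
  have mid_Y: "mid X \<longleftrightarrow> X \<inter> ?B = Y1 \<or> X \<inter> ?B = Y2" for X
    using xy(2) by (auto simp: mid_def Y1_def Y2_def)
  define D where "D Y = card {X \<in> Pow ?J. \<forall>r\<in>R. sum r (Y \<union> X) \<in> {0, 1}}" for Y
  have mid_card: "card {X \<in> Pow J. mid X \<and> P X} = card {X \<in> Pow ?J. P (Y1 \<union> X)} + card {X \<in> Pow ?J. P (Y2 \<union> X)}" for P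
  proof -
    have eq: "{X \<in> Pow J. mid X \<and> P X} = {X \<in> Pow J. X \<inter> ?B = Y1 \<and> P X} \<union> {X \<in> Pow J. X \<inter> ?B = Y2 \<and> P X}"
      using mid_Y by blast
    have "card ({X \<in> Pow J. X \<inter> ?B = Y1 \<and> P X} \<union> {X \<in> Pow J. X \<inter> ?B = Y2 \<and> P X})
        = card {X \<in> Pow J. X \<inter> ?B = Y1 \<and> P X} + card {X \<in> Pow J. X \<inter> ?B = Y2 \<and> P X}"
      by (rule card_Un_disjoint) (use fin(1) Y(3) in auto)
    then show ?thesis
      unfolding eq using card_slice[OF BJ Y(1), of P] card_slice[OF BJ Y(2), of P] by (simp only:)
  qed
  have half: "2 * card {X \<in> Pow J. mid X} = 2 ^ card J"
    using mid_card[of "\<lambda>_. True"] fin(1) unfolding cJ by (simp add: card_Pow Pow_def[symmetric])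
  have ab_mid: "X \<in> sols J {a, b}" if "X \<subseteq> J" "mid X" for X
  proof -
    have "sum a X \<in> {0, 1}"
    proof (rule plane_row_mid[OF fin(1) _ _ xy(2) _ _ Z(1) that(1)])
      show "((x \<in> X) = (y \<in> X)) \<noteq> (a x = a y)" using that(2) by (simp add: mid_def)
    qed (use rows ab(1) bigT[of "{a}"] xy in auto)
    moreover have "sum b X \<in> {0, 1}"
    proof (rule plane_row_mid[OF fin(1) _ _ xy(2) _ _ Z(2) that(1)])
      show "((x \<in> X) = (y \<in> X)) \<noteq> (b x = b y)" using that(2) \<tau>b by (simp add: mid_def)
    qed (use rows ab(2) bigT[of "{b}"] xy in auto)
    ultimately show ?thesis using that(1) by (simp add: sols_def)
  qed
  have "8 * card (sols J {a, b}) = 5 * 2 ^ card J"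
    using pair_values(1)[OF fin(1), of a b] rows ab neq[of a b] bigT[of "{a, b}"] by (auto simp: flat_types_def)
  then have "3 * 2 ^ card J < 8 * card {X \<in> Pow J. mid X \<and> (\<forall>r\<in>R. sum r X \<in> {0, 1})}"
    using mid_dominates[OF fin(1) ab(1,2) _ half ab_mid big] by blast
  also have "card {X \<in> Pow J. mid X \<and> (\<forall>r\<in>R. sum r X \<in> {0, 1})} = D Y1 + D Y2"
    unfolding mid_card D_def ..
  finally have DD: "3 * 2 ^ card ?J < 2 * (D Y1 + D Y2)" unfolding cJ by simp
  have D_le: "D Y \<le> 2 ^ card ?J" for Y
    unfolding D_def using fin(1) by (intro card_Pow_le) simp
  \<comment> \<open>\<open>mid\<close> is more than 3/4 full and consists of two slices of equal
    size. Hence both are more than half full, and one is more than 3/4 full. The latter bounds the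
    supports off {x, y}, after which one half is enough on both slices.\<close>
  have D1: "2 ^ card ?J < 2 * D Y1" and D2: "2 ^ card ?J < 2 * D Y2"
  proof -
    have *: "3 * N < 2 * (p + q) \<Longrightarrow> q \<le> N \<Longrightarrow> N < 2 * p" for N p q :: nat by presburger
    show "2 ^ card ?J < 2 * D Y1" by (rule *[OF DD D_le])
    show "2 ^ card ?J < 2 * D Y2" by (rule *[OF DD[unfolded add.commute[of "D Y1"]] D_le])
  qed
  have "3 * 2 ^ card ?J < 4 * D Y1 \<or> 3 * 2 ^ card ?J < 4 * D Y2"
  proof -
    have *: "3 * N < 2 * (p + q) \<Longrightarrow> 3 * N < 4 * p \<or> 3 * N < 4 * q" for N p q :: nat by presburger
    show ?thesis by (rule *[OF DD])
  qed
  then have supp1: "card (supp ?J r) \<le> 1" if "r \<in> R" for r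
    using slice_full(1)[OF fin(1) BJ Y(1), of r R] slice_full(1)[OF fin(1) BJ Y(2), of r R] rows that
    unfolding D_def by blast
  have full1: "sum r (Y1 \<union> X) \<in> {0, 1}" if "r \<in> R" "X \<subseteq> ?J" for r X
    using slice_full_half[OF fin(1) BJ Y(1) _ supp1[OF that(1)] D1[unfolded D_def] that] rows that(1) by blast
  have full2: "sum r (Y2 \<union> X) \<in> {0, 1}" if "r \<in> R" "X \<subseteq> ?J" for r X
    using slice_full_half[OF fin(1) BJ Y(2) _ supp1[OF that(1)] D2[unfolded D_def] that] rows that(1) by blast
  have full: "sum r X \<in> {0, 1}" if "r \<in> R" "X \<subseteq> J" "mid X" for r X
  proof -
    have "X = (X \<inter> ?B) \<union> (X - ?B)" "X - ?B \<subseteq> ?J" using that(2) by auto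
    then show ?thesis using full1[OF that(1), of "X - ?B"] full2[OF that(1), of "X - ?B"] that(3) unfolding mid_Y by metis
  qed
  have val: "r j = 1 \<or> r j = 0 \<or> r j = -1" if "r \<in> R" "j \<in> J" for r j
    using rows that by (auto simp: signed_on_def)
  have supp_split: "supp J r = (if r x = 0 then {} else {x}) \<union> (if r y = 0 then {} else {y}) \<union> supp ?J r" for r
    using xyJ by (auto simp: supp_def)
  \<comment> \<open>A row outside \<open>Q\<close> has support {x, y} and no private coordinate, so
    it belongs to the base of \<open>star_count\<close>; as supports differ, there is at most
    one.\<close>
  define Q where "Q = {r \<in> R. supp ?J r \<noteq> {}}"
  have "\<exists>z. supp ?J q = {z}" if "q \<in> Q" for q
  proof -
    have "card (supp ?J q) = 1"
      using supp1[of q] that fin(1) card_gt_0_iff[of "supp ?J q"] by (force simp: Q_def)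
    then show ?thesis by (simp add: card_1_singleton_iff)
  qed
  then obtain z where z: "\<And>q. q \<in> Q \<Longrightarrow> supp ?J q = {z q}" by metis
  have zJ: "z q \<in> J" "z q \<noteq> x" "z q \<noteq> y" "q (z q) \<noteq> 0" if "q \<in> Q" for q
    using z[OF that] unfolding supp_def by blast+
  have sum_r: "sum r X = (if x \<in> X then r x else 0) + (if y \<in> X then r y else 0) + (\<Sum>i\<in>supp ?J r. if i \<in> X then r i else 0)"
    if "X \<subseteq> J" for r X
  proof -
    have "sum r X = (\<Sum>i\<in>{x, y} \<union> supp ?J r. if i \<in> X then r i else 0)"
      by (rule sum_eq_supp[OF fin(1) that]) (use fin(1) supp_split in auto)
    also have "\<dots> = (\<Sum>i\<in>{x, y}. if i \<in> X then r i else 0) + (\<Sum>i\<in>supp ?J r. if i \<in> X then r i else 0)"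
      by (rule sum.union_disjoint) (use fin(1) in \<open>auto simp: supp_def\<close>)
    finally show ?thesis using xy(2) by simp
  qed
  have R0: "r x \<noteq> 0" "r y \<noteq> 0" if "r \<in> R - Q" for r
  proof -
    have "supp ?J r = {}" "2 \<le> card (supp J r)" using that rows by (auto simp: Q_def)
    then show "r x \<noteq> 0" "r y \<noteq> 0" using supp_split[of r] by (auto split: if_splits)
  qed
  \<comment> \<open>Being satisfied on both slices for both choices at \<open>z q\<close> pins down
    the signs: x + y - z if \<open>a x = a y\<close>, otherwise z plus or minus (x - y).\<close>
  have Q: "q x \<noteq> 0" "q y \<noteq> 0"
    "a x = a y \<Longrightarrow> q x = 1 \<and> q y = 1 \<and> q (z q) = -1" "a x \<noteq> a y \<Longrightarrow> q y = - q x \<and> q (z q) = 1" if "q \<in> Q" for q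
  proof -
    have qR: "q \<in> R" using that by (simp add: Q_def)
    have zq: "{z q} \<subseteq> ?J" using zJ[OF that] by simp
    have "2 \<le> card (supp J q)" using rows qR by blast
    then have nz: "\<not> (q x = 0 \<and> q y = 0)" using supp_split[of q] z[OF that] by auto
    have sub: "Y1 \<subseteq> J" "Y2 \<subseteq> J" "Y1 \<union> {z q} \<subseteq> J" "Y2 \<union> {z q} \<subseteq> J" using Y BJ zJ[OF that] by auto
    have f: "sum q Y1 \<in> {0, 1}" "sum q Y2 \<in> {0, 1}" "sum q (Y1 \<union> {z q}) \<in> {0, 1}" "sum q (Y2 \<union> {z q}) \<in> {0, 1}"
      using full1[OF qR, of "{}"] full2[OF qR, of "{}"] full1[OF qR zq] full2[OF qR zq] by simp_all
    have zY: "z q \<notin> Y1" "z q \<notin> Y2" using Y zJ[OF that] by auto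
    note f = f[unfolded sum_r[OF sub(1)] sum_r[OF sub(2)] sum_r[OF sub(3)] sum_r[OF sub(4)] z[OF that]]
    have "(a x = a y \<longrightarrow> q x = 1 \<and> q y = 1 \<and> q (z q) = -1) \<and> (a x \<noteq> a y \<longrightarrow> q y = - q x \<and> q (z q) = 1)"
      using f nz zJ[OF that] xy(2) zY val[OF qR xyJ(1)] val[OF qR xyJ(2)] val[OF qR zJ(1)[OF that]]
      unfolding Y1_def Y2_def by (cases "a x = a y") auto
    then show "q x \<noteq> 0" "q y \<noteq> 0"
      "a x = a y \<Longrightarrow> q x = 1 \<and> q y = 1 \<and> q (z q) = -1" "a x \<noteq> a y \<Longrightarrow> q y = - q x \<and> q (z q) = 1"
      using nz by (cases "a x = a y"; auto)+
  qed
  have supp_Q: "supp J q = {x, y, z q}" if "q \<in> Q" for q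
    using supp_split[of q] Q(1,2)[OF that] z[OF that] by auto
  have supp_R0: "supp J r = {x, y}" if "r \<in> R - Q" for r
    using supp_split[of r] R0[OF that] that by (auto simp: Q_def)
  have supp_ne: "supp J r \<noteq> supp J q" if "r \<in> R" "q \<in> R" "r \<noteq> q" for r q
    using supp_neq[OF fin(1) _ big that(1,2) neq[OF that]] rows by blast
  have z_ne: "z r \<noteq> z q" if "r \<in> Q" "q \<in> Q" "r \<noteq> q" for r q
    using supp_ne[of r q] supp_Q[OF that(1)] supp_Q[OF that(2)] that by (auto simp: Q_def)
  have count: "2 ^ card Q * (2 * card (sols J ((R - Q) \<union> Q))) + 2 ^ card J = 2 ^ card Q * 2 ^ card J + 2 * card (sols J (R - Q))"
  proof (rule star_count[where z = z and mid = mid, OF fin(1)])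
    show "r (z q) = 0" if "q \<in> Q" "r \<in> (R - Q) \<union> Q" "r \<noteq> q" for q r
    proof -
      have "z q \<notin> supp J r"
      proof (cases "r \<in> Q")
        case True
        then show ?thesis using supp_Q[OF True] z_ne[OF True that(1,3)] zJ[OF that(1)] by auto
      next
        case False
        then show ?thesis using supp_R0[of r] that(2) zJ[OF that(1)] by auto
      qed
      then show ?thesis using zJ(1)[OF that(1)] by (simp add: supp_def)
    qed
    show "mid (insert (z q) X) \<longleftrightarrow> mid X" if "q \<in> Q" for q X
      using zJ[OF that] by (simp add: mid_def)
    show "sum q (insert (z q) X) \<in> {0, 1} \<longleftrightarrow> sum q X \<notin> {0, 1}" if "q \<in> Q" "X \<subseteq> J - {z q}" "\<not> mid X" for q X
    proof -
      have X: "insert (z q) X \<subseteq> J" "X \<subseteq> J" "z q \<notin> X"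
        using that(2) zJ[OF that(1)] by auto
      have mem: "x \<in> insert (z q) X \<longleftrightarrow> x \<in> X" "y \<in> insert (z q) X \<longleftrightarrow> y \<in> X" using zJ[OF that(1)] by auto
      have vx: "q x = 1 \<or> q x = -1" using val[of q x] that(1) xyJ Q(1)[OF that(1)] by (auto simp: Q_def)
      show ?thesis
        unfolding sum_r[OF X(1)] sum_r[OF X(2)] mem z[OF that(1)]
        using that(3) Q(3,4)[OF that(1)] X(3) vx unfolding mid_def
        by (cases "a x = a y"; cases "x \<in> X"; cases "y \<in> X") auto
    qed
  qed (use fin full zJ(1) half in \<open>auto simp: Q_def\<close>)
  have RQ: "(R - Q) \<union> Q = R" by (auto simp: Q_def)
  have cR: "card R = card (R - Q) + card Q"
    using card_Un_disjoint[of "R - Q" Q] fin(2) RQ by (auto simp: Q_def)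
  have "r = q" if "r \<in> R - Q" "q \<in> R - Q" for r q
    using supp_ne[of r q] supp_R0[OF that(1)] supp_R0[OF that(2)] that by blast
  then have cR0: "card (R - Q) \<le> 1"
    using fin(2) by (intro card_le_Suc0_iff_eq[THEN iffD2, unfolded One_nat_def[symmetric]]) auto
  show "2 ^ card R * (2 * card (sols J R)) = 2 ^ card R * 2 ^ card J + 2 ^ card J"
  \<comment> \<open>The base has excess 1/2 over one half if empty and 1/4 if it is a single row of
    density 3/4: in both cases a power of 2 that fits the total number of rows.\<close>
  proof (cases "R - Q = {}")
    case True
    have "card (sols J {}) = 2 ^ card J" using fin(1) by (simp add: sols_def card_Pow Pow_def[symmetric])
    with count[unfolded RQ] cR show ?thesis unfolding True by simp
  next
    case False
    then have "card (R - Q) = 1" using cR0 fin(2) card_gt_0_iff[of "R - Q"] by force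
    then obtain h where h: "R - Q = {h}" by (auto simp: card_1_singleton_iff)
    then have hR: "h \<in> R" "h \<in> R - Q" by auto
    then have "card (supp J h) = 2" using supp_R0[OF hR(2)] xy(2) by simp
    then have "4 * card (sols J {h}) = 3 * 2 ^ card J"
      using card_single_values[OF fin(1), of h] rows hR(1) bigT[of "{h}"] by auto
    moreover have "card R = Suc (card Q)" using cR \<open>card (R - Q) = 1\<close> by simp
    ultimately show ?thesis using count[unfolded RQ] unfolding h by simp
  qed
  \<comment> \<open>The private coordinates avoid \<open>x\<close> and \<open>y\<close>, and at most
    one row has none, so the total is at most \<open>card J - 1\<close>.\<close>
  have "card Q \<le> card ?J"
  proof (rule card_inj_on_le[of z])
    show "inj_on z Q" using z_ne by (auto intro: inj_onI)
    show "z ` Q \<subseteq> ?J" using zJ by auto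
  qed (use fin in auto)
  then show "card R < card J" using cJ cR cR0 by simp
qed

section \<open>Spectrum of intersection sizes\<close>

text \<open>The lower bounds on \<open>card R\<close> record from how many rows on each value can
  occur.\<close>

theorem sols_spectrum:
  assumes fin: "finite J" "finite R"
    and rows: "\<forall>r\<in>R. signed_on J r \<and> 2 \<le> card (supp J r)"
    and neq: "\<And>a b. a \<in> R \<Longrightarrow> b \<in> R \<Longrightarrow> a \<noteq> b \<Longrightarrow> \<exists>j\<in>J. a j \<noteq> b j"
    and big: "2 ^ card J < 2 * card (sols J R)"
  defines "c \<equiv> card (sols J R)" and "N \<equiv> 2 ^ card J"
  shows "c = N \<or> 1 \<le> card R \<and> (4 * c = 3 * N \<or> 8 * c = 5 * N \<or> 64 * c = 35 * N)
    \<or> 2 \<le> card R \<and> 16 * c = 9 * N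
    \<or> 3 \<le> card R \<and> card R < card J \<and> 2 ^ card R * (2 * c) = 2 ^ card R * N + N"
proof -
  consider "R = {}" | r where "R = {r}" | a b where "R = {a, b}" "a \<noteq> b" | "3 \<le> card R"
  proof -
    have "card R = 0 \<or> card R = 1 \<or> card R = 2 \<or> 3 \<le> card R" by arith
    then show ?thesis using that fin(2) by (auto simp: card_1_singleton_iff card_2_iff)
  qed
  then show ?thesis
  proof cases
    case 1
    then show ?thesis using fin(1) by (simp add: c_def N_def sols_def card_Pow Pow_def[symmetric])
  next
    case 2
    then have "signed_on J r" "2 \<le> card (supp J r)" "2 ^ card J < 2 * card (sols J {r})" using rows big by auto
    from card_single_values[OF fin(1) this] 2 show ?thesis unfolding c_def N_def by auto
  next
    case 3
    then have "signed_on J a" "signed_on J b" "2 \<le> card (supp J a)" "2 \<le> card (supp J b)" "\<exists>j\<in>J. a j \<noteq> b j"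
      "2 ^ card J < 2 * card (sols J {a, b})" using rows big neq by auto
    from pair_values(1)[OF fin(1) this] 3 show ?thesis unfolding c_def N_def by auto
  next
    case 4
    obtain a b where ab: "a \<in> R" "b \<in> R" "a \<noteq> b" "overlap J a b \<in> star_types"
      using star_pair_exists[OF fin(1) rows neq 4 big] by blast
    have "2 ^ card R * (2 * c) = 2 ^ card R * N + N \<and> card R < card J"
    proof (cases "overlap J a b = (1, 1, 1)")
      case True
      from star_count_edges[OF fin rows neq ab(1-3) this big] show ?thesis unfolding c_def N_def by blast
    next
      case False
      then have "overlap J a b \<in> {(1, 0, 2), (0, 1, 2), (1, 1, 2)}" using ab(4) by (simp add: star_types_def)
      from star_count_planes[OF fin rows neq ab(1-3) this big] show ?thesis unfolding c_def N_def by blast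
    qed
    then show ?thesis using 4 by blast
  qed
qed

section \<open>From real matrices to sets of integer rows\<close>

lemma card_cube_sols:
  "card {x \<in> cube k. \<forall>i<m. (\<Sum>j<k. A i j * x j) = 0 \<or> (\<Sum>j<k. A i j * x j) = 1} =
   card {X \<in> Pow {..<k}. \<forall>i<m. sum (A i) X \<in> {0, 1}}"
proof -
  define f :: "nat set \<Rightarrow> nat \<Rightarrow> real" where "f X j = (if j \<in> X then 1 else 0)" for X j
  have sum_f: "(\<Sum>j<k. A i j * f X j) = sum (A i) X" if "X \<subseteq> {..<k}" for X i
  proof -
    have "(\<Sum>j<k. A i j * f X j) = (\<Sum>j<k. if j \<in> X then A i j else 0)"
      by (intro sum.cong) (auto simp: f_def)
    also have "\<dots> = sum (A i) ({..<k} \<inter> X)" by (simp add: sum.inter_restrict)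
    finally show ?thesis using that by (simp add: Int_absorb1)
  qed
  have inj: "inj_on f {X \<in> Pow {..<k}. \<forall>i<m. sum (A i) X \<in> {0, 1}}"
  proof (rule inj_onI)
    fix X Y assume "f X = f Y"
    then have "j \<in> X \<longleftrightarrow> j \<in> Y" for j by (auto dest!: fun_cong[where x = j] simp: f_def split: if_splits)
    then show "X = Y" by blast
  qed
  have "{x \<in> cube k. \<forall>i<m. (\<Sum>j<k. A i j * x j) = 0 \<or> (\<Sum>j<k. A i j * x j) = 1} =
      f ` {X \<in> Pow {..<k}. \<forall>i<m. sum (A i) X \<in> {0, 1}}"
  proof (intro equalityI subsetI)
    fix x assume x: "x \<in> {x \<in> cube k. \<forall>i<m. (\<Sum>j<k. A i j * x j) = 0 \<or> (\<Sum>j<k. A i j * x j) = 1}"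
    define X where "X = {j. j < k \<and> x j = 1}"
    have X: "X \<subseteq> {..<k}" by (auto simp: X_def)
    have fX: "x = f X"
    proof
      fix j
      have "x j = 0 \<or> x j = 1" "\<not> j < k \<Longrightarrow> x j = 0" using x by (cases "j < k"; simp add: cube_def)+
      then show "x j = f X j" by (auto simp: f_def X_def)
    qed
    have "\<forall>i<m. (\<Sum>j<k. A i j * x j) = 0 \<or> (\<Sum>j<k. A i j * x j) = 1" using x by blast
    then have "\<forall>i<m. sum (A i) X \<in> {0, 1}" unfolding fX sum_f[OF X] by simp
    with X show "x \<in> f ` {X \<in> Pow {..<k}. \<forall>i<m. sum (A i) X \<in> {0, 1}}"
      by (intro image_eqI[where x = X] fX) simp
  next
    fix x assume "x \<in> f ` {X \<in> Pow {..<k}. \<forall>i<m. sum (A i) X \<in> {0, 1}}"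
    then obtain X where X: "X \<subseteq> {..<k}" "\<forall>i<m. sum (A i) X \<in> {0, 1}" and x: "x = f X" by auto
    have "x \<in> cube k" using X(1) by (auto simp: x f_def cube_def)
    then show "x \<in> {x \<in> cube k. \<forall>i<m. (\<Sum>j<k. A i j * x j) = 0 \<or> (\<Sum>j<k. A i j * x j) = 1}"
      using X(2) by (simp add: x sum_f[OF X(1)])
  qed
  then show ?thesis by (simp only: card_image[OF inj])
qed

lemma H_iff:
  "h \<in> H (k + m) k \<longleftrightarrow> (\<exists>A :: nat \<Rightarrow> nat \<Rightarrow> real. h = card {X \<in> Pow {..<k}. \<forall>i<m. sum (A i) X \<in> {0, 1}})"
  unfolding H_def card_cube_sols by simp

lemma sols_in_H:
  assumes "finite R" "card R \<le> m"
  shows "card (sols {..<k} R) \<in> H (k + m) k"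
proof -
  define n where "n = card R"
  obtain f where "bij_betw f {0..<n} R" unfolding n_def using ex_bij_betw_nat_finite[OF assms(1)] ..
  then have f: "R = f ` {0..<n}" by (simp add: bij_betw_imp_surj_on)
  have n: "n \<le> m" using assms(2) by (simp add: n_def)
  \<comment> \<open>Padding with zero rows imposes no condition, so fewer than \<open>m\<close> rows
    are enough.\<close>
  define A :: "nat \<Rightarrow> nat \<Rightarrow> real" where "A i j = (if i < n then of_int (f i j) else 0)" for i j
  have sum_A: "sum (A i) X = (if i < n then of_int (sum (f i) X) else 0)" for i X
    by (simp add: A_def)
  have win: "sum (A i) X \<in> {0, 1} \<longleftrightarrow> (i < n \<longrightarrow> sum (f i) X \<in> {0, 1})" for i X
    unfolding sum_A by (cases "i < n") (simp_all del: of_int_sum)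
  have "sols {..<k} R = {X \<in> Pow {..<k}. \<forall>i<n. sum (f i) X \<in> {0, 1}}"
    unfolding sols_def f by auto
  also have "\<dots> = {X \<in> Pow {..<k}. \<forall>i<m. sum (A i) X \<in> {0, 1}}"
    unfolding win using n by (intro Collect_cong conj_cong refl) (auto dest: less_le_trans)
  finally show ?thesis unfolding H_iff by auto
qed

lemma H_large_rows:
  assumes "h \<in> H (k + m) k" "2 ^ k < 2 * h"
  obtains R where "finite R" "card R \<le> m" "\<forall>r\<in>R. signed_on {..<k} r \<and> 2 \<le> card (supp {..<k} r)"
    "\<forall>a\<in>R. \<forall>b\<in>R. a \<noteq> b \<longrightarrow> (\<exists>j\<in>{..<k}. a j \<noteq> b j)" "h = card (sols {..<k} R)"
proof -
  let ?J = "{..<k}"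
  obtain A :: "nat \<Rightarrow> nat \<Rightarrow> real" where h: "h = card {X \<in> Pow ?J. \<forall>i<m. sum (A i) X \<in> {0, 1}}"
    using assms(1) unfolding H_iff by blast
  have entries: "A i j \<in> {-1, 0, 1}" if "i < m" "j < k" for i j
  proof (rule ccontr)
    assume A: "A i j \<notin> {-1, 0, 1}"
    have "2 * h \<le> 2 ^ card ?J"
      unfolding h
    proof (rule card_Pow_half[of ?J j])
      fix X assume X: "X \<subseteq> ?J - {j}"
      then have "sum (A i) (insert j X) = A i j + sum (A i) X"
        by (subst sum.insert) (auto intro: finite_subset)
      then have "\<not> (sum (A i) X \<in> {0, 1} \<and> sum (A i) (insert j X) \<in> {0, 1})"
        using A by auto
      then show "\<not> ((\<forall>i<m. sum (A i) X \<in> {0, 1}) \<and> (\<forall>i<m. sum (A i) (insert j X) \<in> {0, 1}))"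
        using that(1) by blast
    qed (use that in auto)
    then show False using assms(2) by simp
  qed
  \<comment> \<open>The floor is exact for the entries in question. The value 0 beyond
    \<open>k\<close> makes distinct rows differ at some \<open>j < k\<close>; repeated matrix rows
    merge in the image.\<close>
  define r :: "nat \<Rightarrow> nat \<Rightarrow> int" where "r i j = (if j < k then \<lfloor>A i j\<rfloor> else 0)" for i j
  have rA: "real_of_int (r i j) = A i j" "r i j \<in> {-1, 0, 1}" if "i < m" "j < k" for i j
  proof -
    note e = entries[OF that]
    obtain z :: int where z: "z \<in> {-1, 0, 1}" "A i j = of_int z"
    proof -
      assume *: "\<And>z::int. z \<in> {-1, 0, 1} \<Longrightarrow> A i j = of_int z \<Longrightarrow> thesis"
      show thesis using e *[of "-1"] *[of 0] *[of 1] by auto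
    qed
    then show "real_of_int (r i j) = A i j" "r i j \<in> {-1, 0, 1}" using that(2) by (simp_all add: r_def)
  qed
  have sum_r: "sum (A i) X \<in> {0, 1} \<longleftrightarrow> sum (r i) X \<in> {0, 1}" if "i < m" "X \<subseteq> ?J" for i X
  proof -
    have "sum (A i) X = (\<Sum>j\<in>X. real_of_int (r i j))"
      using rA(1)[OF that(1)] that(2) by (intro sum.cong refl) auto
    also have "\<dots> = real_of_int (sum (r i) X)" by simp
    finally show ?thesis by (simp del: of_int_sum)
  qed
  have h': "h = card (sols ?J (r ` {..<m}))"
    unfolding h sols_def by (intro arg_cong[where f = card] Collect_cong conj_cong refl) (use sum_r in auto)
  have signed: "signed_on ?J q" if "q \<in> r ` {..<m}" for q
    using that rA(2) unfolding signed_on_def by blast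
  define R where "R = {q \<in> r ` {..<m}. 2 \<le> card (supp ?J q)}"
  have trivial: "sum q X \<in> {0, 1}" if "q \<in> r ` {..<m}" "q \<notin> R" "X \<subseteq> ?J" for q X
  proof -
    have "card (supp ?J q) \<le> 1" using that(1,2) by (auto simp: R_def)
    moreover have "h \<le> card {X \<in> Pow ?J. sum q X \<in> {0, 0 + 1}}"
      unfolding h' sols_def by (rule card_Pow_mono) (use that(1) in auto)
    then have "\<not> 2 * card {X \<in> Pow ?J. sum q X \<in> {0, 0 + 1}} \<le> 2 ^ card ?J" using assms(2) by simp
    ultimately have "\<forall>X\<subseteq>?J. sum q X \<in> {0, 0 + 1}"
      using card_single_small_supp[OF _ signed[OF that(1)], of 0] by blast
    then show ?thesis using that(3) by simp
  qed
  show ?thesis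
  proof (rule that[of R])
    show "finite R" by (simp add: R_def)
    have "card R \<le> card (r ` {..<m})" by (rule card_mono) (auto simp: R_def)
    also have "\<dots> \<le> m" using card_image_le[of "{..<m}" r] by simp
    finally show "card R \<le> m" .
    show "\<forall>q\<in>R. signed_on ?J q \<and> 2 \<le> card (supp ?J q)" using signed by (auto simp: R_def)
    show "\<forall>a\<in>R. \<forall>b\<in>R. a \<noteq> b \<longrightarrow> (\<exists>j\<in>?J. a j \<noteq> b j)"
    proof (intro ballI impI)
      fix a b assume ab: "a \<in> R" "b \<in> R" "a \<noteq> b"
      then obtain j where "a j \<noteq> b j" by (auto simp: fun_eq_iff)
      moreover from this have "j < k" using ab(1,2) by (auto simp: R_def r_def split: if_splits)
      ultimately show "\<exists>j\<in>?J. a j \<noteq> b j" by auto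
    qed
    have "R \<subseteq> r ` {..<m}" by (auto simp: R_def)
    then have "(\<forall>q\<in>r ` {..<m}. sum q X \<in> {0, 1}) \<longleftrightarrow> (\<forall>q\<in>R. sum q X \<in> {0, 1})" if "X \<in> Pow ?J" for X
      using trivial[where X = X] that by (meson PowD subsetD)
    then have "sols ?J (r ` {..<m}) = sols ?J R"
      unfolding sols_def by (intro Collect_cong conj_cong refl)
    then show "h = card (sols ?J R)" using h' by simp
  qed
qed

text \<open>As fractions of \<open>2 ^ k\<close>: 1, 3/4, 5/8, 35/64, 9/16, and the star values.
  Stars with \<open>n = 1\<close> and \<open>n = 2\<close> would repeat 3/4 and 5/8.\<close>

definition spectrum :: "nat \<Rightarrow> nat \<Rightarrow> nat set" where
  "spectrum m k = {2 ^ k, 3 * 2 ^ (k - 2), 5 * 2 ^ (k - 3), 35 * 2 ^ (k - 6)}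
    \<union> (if 2 \<le> m then {9 * 2 ^ (k - 4)} else {})
    \<union> {2 ^ (k - 1) + 2 ^ (k - 1 - n) |n. 3 \<le> n \<and> n \<le> m \<and> n < k}"

lemma H_large_in_spectrum:
  assumes "6 \<le> k" "h \<in> H (k + m) k" "2 ^ k < 2 * h"
  shows "h \<in> spectrum m k"
proof -
  obtain R where R: "finite R" "card R \<le> m" "\<forall>r\<in>R. signed_on {..<k} r \<and> 2 \<le> card (supp {..<k} r)"
    "\<forall>a\<in>R. \<forall>b\<in>R. a \<noteq> b \<longrightarrow> (\<exists>j\<in>{..<k}. a j \<noteq> b j)" "h = card (sols {..<k} R)"
    by (rule H_large_rows[OF assms(2,3)])
  have p: "(2::nat) ^ k = 2 ^ n * 2 ^ (k - n)" if "n \<le> 6" for n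
    using that assms(1) by (simp flip: power_add)
  have pow: "(2::nat) ^ k = 4 * 2 ^ (k - 2)" "(2::nat) ^ k = 8 * 2 ^ (k - 3)" "(2::nat) ^ k = 16 * 2 ^ (k - 4)"
    "(2::nat) ^ k = 64 * 2 ^ (k - 6)"
    by (subst p[of 2] p[of 3] p[of 4] p[of 6]; simp)+
  have "2 ^ card {..<k} < 2 * card (sols {..<k} R)" using assms(3) R(5) by simp
  from sols_spectrum[OF finite_lessThan R(1,3) _ this] R(4)
  consider "h = 2 ^ k" | "4 * h = 3 * 2 ^ k" | "8 * h = 5 * 2 ^ k" | "64 * h = 35 * 2 ^ k"
    | "2 \<le> m" "16 * h = 9 * 2 ^ k"
    | "3 \<le> card R" "card R < k" "2 ^ card R * (2 * h) = 2 ^ card R * 2 ^ k + 2 ^ k"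
    using R(2,5) by fastforce
  then show ?thesis
  proof cases
    case 1
    then show ?thesis by (simp add: spectrum_def)
  next
    case 2
    then show ?thesis unfolding pow(1) by (simp add: spectrum_def)
  next
    case 3
    then show ?thesis unfolding pow(2) by (simp add: spectrum_def)
  next
    case 4
    then show ?thesis unfolding pow(4) by (simp add: spectrum_def)
  next
    case 5
    from this(2) have "h = 9 * 2 ^ (k - 4)" unfolding pow(3) by simp
    with 5(1) show ?thesis by (simp add: spectrum_def)
  next
    case 6
    have k: "k = Suc (card R + (k - 1 - card R))" "k = Suc (k - 1)" using 6(2) by auto
    have "(2::nat) ^ k = 2 ^ card R * (2 * 2 ^ (k - 1 - card R))"
      by (subst k(1)) (simp add: power_add)
    moreover have "(2::nat) ^ k = 2 * 2 ^ (k - 1)" by (subst k(2)) simp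
    ultimately have "2 ^ card R * (2 * h) = 2 ^ card R * (2 * 2 ^ (k - 1) + 2 * 2 ^ (k - 1 - card R))"
      using 6(3) unfolding distrib_left by simp
    then have "2 * h = 2 * 2 ^ (k - 1) + 2 * 2 ^ (k - 1 - card R)" by simp
    then have "h = 2 ^ (k - 1) + 2 ^ (k - 1 - card R)" by simp
    with 6(1,2) R(2) show ?thesis unfolding spectrum_def by blast
  qed
qed

section \<open>Realising every value\<close>

text \<open>For (p, q) = (2, 0), (3, 1), (4, 2) the shift by \<open>q\<close> hits a central
  coefficient: 3 of 4, 10 of 16, 35 of 64.\<close>

lemma card_sols_row:
  assumes "p + q \<le> k"
  shows "card (sols {..<k} {\<lambda>j. if j < p then 1 else if j < p + q then -1 else 0}) = 2 ^ (k - (p + q)) * layers (p + q) (int q)"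
proof -
  define r :: "nat \<Rightarrow> int" where "r = (\<lambda>j. if j < p then 1 else if j < p + q then -1 else 0)"
  have "{j \<in> {..<k}. r j = 0} = {p + q..<k}" "supp {..<k} r = {..<p + q}" "{j \<in> {..<k}. r j = -1} = {p..<p + q}"
    using assms by (auto simp: r_def supp_def split: if_splits)
  moreover have "signed_on {..<k} r" by (simp add: signed_on_def r_def)
  ultimately have "card {X \<in> Pow {..<k}. sum r X \<in> {0, 0 + 1}} = 2 ^ (k - (p + q)) * layers (p + q) (0 + int q)"
    using card_single[of "{..<k}" r 0] by simp
  then show ?thesis unfolding r_def[symmetric] by (simp add: sols_def)
qed

lemma card_sols_disjoint_edges:
  assumes "4 \<le> k"
  shows "card (sols {..<k} {\<lambda>j. if j < 2 then 1 else 0, \<lambda>j. if 2 \<le> j \<and> j < 4 then 1 else 0}) = 9 * 2 ^ (k - 4)"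
proof -
  define a b :: "nat \<Rightarrow> int" where "a = (\<lambda>j. if j < 2 then 1 else 0)" and "b = (\<lambda>j. if 2 \<le> j \<and> j < 4 then 1 else 0)"
  have sets: "{j \<in> {..<k}. a j = 0 \<and> b j = 0} = {4..<k}" "{j \<in> {..<k}. a j \<noteq> 0 \<and> b j = 0} = {..<2}"
    "{j \<in> {..<k}. a j = 0 \<and> b j \<noteq> 0} = {2..<4}" "{j \<in> {..<k}. a j \<noteq> 0 \<and> b j \<noteq> 0} = {}"
    "{j \<in> {..<k}. a j = -1} = {}" "{j \<in> {..<k}. b j = -1} = {}"
    using assms by (auto simp: a_def b_def split: if_splits)
  have signs: "signed_on {..<k} a" "signed_on {..<k} b" "\<forall>j\<in>{..<k}. a j \<noteq> 0 \<longrightarrow> b j \<noteq> 0 \<longrightarrow> a j = b j"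
    by (auto simp: signed_on_def a_def b_def)
  have "card {X \<in> Pow {..<k}. sum a X \<in> {0, 0 + 1} \<and> sum b X \<in> {0, 0 + 1}} = 2 ^ (k - 4) * layers2 2 2 0 0 0"
    unfolding card_pair[OF finite_lessThan signs] sets by simp
  then show ?thesis unfolding a_def[symmetric] b_def[symmetric] by (simp add: sols_def layers_g_numeral)
qed

text \<open>The rows are x_0 + x_t for t = 1, ..., n: either x_0 = 0, or x_0 = 1 and all these x_t
  vanish.\<close>

lemma star_in_H:
  assumes "n \<le> m" "n < k"
  shows "2 ^ (k - 1) + 2 ^ (k - 1 - n) \<in> H (k + m) k"
proof -
  define q :: "nat \<Rightarrow> nat \<Rightarrow> int" where "q t j = (if j = 0 \<or> j = t then 1 else 0)" for t j
  let ?J = "{..<k}"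
  have sum_q: "sum (q t) X = (if 0 \<in> X then 1 else 0) + (if t \<in> X then 1 else 0)" if "X \<subseteq> ?J" "1 \<le> t" for X t
  proof -
    have "supp ?J (q t) \<subseteq> {0, t}" by (auto simp: q_def supp_def split: if_splits)
    from sum_eq_supp[OF finite_lessThan that(1) _ this] show ?thesis using that(2) by (simp add: q_def)
  qed
  have "sols ?J (q ` {1..n}) = {X \<in> Pow ?J. X \<inter> {0} = {}} \<union> {X \<in> Pow ?J. X \<inter> {0..n} = {0}}"
  proof (intro equalityI subsetI)
    fix X assume X: "X \<in> sols ?J (q ` {1..n})"
    then have sub: "X \<subseteq> ?J" by (simp add: sols_def)
    show "X \<in> {X \<in> Pow ?J. X \<inter> {0} = {}} \<union> {X \<in> Pow ?J. X \<inter> {0..n} = {0}}"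
    proof (cases "0 \<in> X")
      case True
      have "t \<notin> X" if "t \<in> {1..n}" for t
      proof -
        have "sum (q t) X \<in> {0, 1}" using X that unfolding sols_def by blast
        then show ?thesis using sum_q[OF sub, of t] True that by auto
      qed
      then have "X \<inter> {0..n} = {0}" using True by (force simp: Suc_le_eq)
      then show ?thesis using sub by simp
    qed (use sub in simp)
  next
    fix X assume X: "X \<in> {X \<in> Pow ?J. X \<inter> {0} = {}} \<union> {X \<in> Pow ?J. X \<inter> {0..n} = {0}}"
    then have sub: "X \<subseteq> ?J" by auto
    have "sum (q t) X \<in> {0, 1}" if "t \<in> {1..n}" for t
    proof -
      have t: "t \<in> {0..n}" "t \<noteq> 0" "1 \<le> t" using that by simp_all
      have "X \<inter> {0} = {} \<or> X \<inter> {0..n} = {0}" using X by blast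
      then have "0 \<notin> X \<or> t \<notin> X"
      proof
        assume "X \<inter> {0..n} = {0}"
        then have "t \<in> X \<longrightarrow> t \<in> {0}" using t(1) by (metis IntI)
        with t(2) show ?thesis by simp
      qed simp
      then show ?thesis unfolding sum_q[OF sub t(3)] by auto
    qed
    then show "X \<in> sols ?J (q ` {1..n})" using sub unfolding sols_def by blast
  qed
  moreover have "card ({X \<in> Pow ?J. X \<inter> {0} = {}} \<union> {X \<in> Pow ?J. X \<inter> {0..n} = {0}}) = 2 ^ card (?J - {0}) + 2 ^ card (?J - {0..n})"
  proof -
    have sub: "{0} \<subseteq> ?J" "{0..n} \<subseteq> ?J" "{0} \<subseteq> {0..n}" using assms(2) by auto
    have "card {X \<in> Pow ?J. X \<inter> {0} = {}} = 2 ^ card (?J - {0})"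
      by (rule card_slice_all[OF finite_lessThan sub(1)]) simp
    moreover have "card {X \<in> Pow ?J. X \<inter> {0..n} = {0}} = 2 ^ card (?J - {0..n})"
      by (rule card_slice_all[OF finite_lessThan sub(2,3)])
    moreover have "{X \<in> Pow ?J. X \<inter> {0} = {}} \<inter> {X \<in> Pow ?J. X \<inter> {0..n} = {0}} = {}" by auto
    ultimately show ?thesis by (subst card_Un_disjoint) simp_all
  qed
  moreover have "card (?J - {0}) = k - 1" using assms(2) by simp
  moreover have "card (?J - {0..n}) = k - 1 - n" using assms(2) by (subst card_Diff_subset) auto
  ultimately have "card (sols ?J (q ` {1..n})) = 2 ^ (k - 1) + 2 ^ (k - 1 - n)" by simp
  moreover have "card (q ` {1..n}) \<le> m" using card_image_le[of "{1..n}" q] assms(1) by simp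
  ultimately show ?thesis using sols_in_H[of "q ` {1..n}" m k] by simp
qed

lemma spectrum_in_H:
  assumes "6 \<le> k" "1 \<le> m" "h \<in> spectrum m k"
  shows "h \<in> H (k + m) k"
proof -
  have "k - 3 = Suc (k - 4)" using assms(1) by simp
  then have pow: "(2::nat) ^ (k - 3) = 2 * 2 ^ (k - 4)" by (simp only: power_Suc)
  consider "h = 2 ^ k" | "h = 3 * 2 ^ (k - 2)" | "h = 5 * 2 ^ (k - 3)" | "h = 35 * 2 ^ (k - 6)"
    | "2 \<le> m" "h = 9 * 2 ^ (k - 4)" | n where "n \<le> m" "n < k" "h = 2 ^ (k - 1) + 2 ^ (k - 1 - n)"
    using assms(3) unfolding spectrum_def by (auto split: if_splits)
  then show ?thesis
  proof cases
    case 1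
    have "card (sols {..<k} {}) = 2 ^ k" by (simp add: sols_def card_Pow Pow_def[symmetric])
    then show ?thesis using sols_in_H[of "{}" m k] 1 by simp
  next
    case 2
    have "card (sols {..<k} {\<lambda>j. if j < 2 then 1 else if j < 2 + 0 then -1 else 0}) = h"
      using card_sols_row[of 2 0 k] assms(1) by (simp add: layers_g_numeral 2)
    then show ?thesis using sols_in_H[of "{\<lambda>j. if j < 2 then 1 else if j < 2 + 0 then -1 else 0}" m k] assms(2) by simp
  next
    case 3
    have "card (sols {..<k} {\<lambda>j. if j < 3 then 1 else if j < 3 + 1 then -1 else 0}) = h"
      using card_sols_row[of 3 1 k] assms(1) by (simp add: layers_g_numeral 3 pow)
    then show ?thesis using sols_in_H[of "{\<lambda>j. if j < 3 then 1 else if j < 3 + 1 then -1 else 0}" m k] assms(2) by simp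
  next
    case 4
    have "card (sols {..<k} {\<lambda>j. if j < 4 then 1 else if j < 4 + 2 then -1 else 0}) = h"
      using card_sols_row[of 4 2 k] assms(1) by (simp add: layers_g_numeral 4)
    then show ?thesis using sols_in_H[of "{\<lambda>j. if j < 4 then 1 else if j < 4 + 2 then -1 else 0}" m k] assms(2) by simp
  next
    case 5
    let ?R = "{\<lambda>j. if j < 2 then 1 else 0, \<lambda>j. if 2 \<le> j \<and> j < 4 then 1 else 0} :: (nat \<Rightarrow> int) set"
    have "card ?R \<le> m" using 5(1) by (simp add: card_insert_if)
    then show ?thesis using sols_in_H[of ?R m k] card_sols_disjoint_edges[of k] assms(1) 5(2) by simp
  next
    case 6
    then show ?thesis using star_in_H by blast
  qed
qed

lemma Hplus_eq_spectrum:
  assumes "6 \<le> k" "1 \<le> m"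
  shows "Hplus (k + m) k = spectrum m k"
proof -
  have k: "(2::nat) ^ k = 2 * 2 ^ (k - 1)"
    using assms(1) by (simp flip: power_Suc)
  \<comment> \<open>\<open>Hplus\<close> removes only sizes from 1 on, so 0 is excluded separately:
    the empty set solves every system.\<close>
  have pos: "0 < h" if mem: "h \<in> H (k + m) k" for h
  proof -
    obtain A :: "nat \<Rightarrow> nat \<Rightarrow> real" where h: "h = card {X \<in> Pow {..<k}. \<forall>i<m. sum (A i) X \<in> {0, 1}}"
      using mem unfolding H_iff by blast
    have "{} \<in> {X \<in> Pow {..<k}. \<forall>i<m. sum (A i) X \<in> {0, 1}}" by simp
    then show ?thesis unfolding h card_gt_0_iff by (intro conjI) (blast, simp)
  qed
  have large: "2 ^ (k - 1) < h" if "h \<in> spectrum m k" for h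
  proof -
    obtain l where l: "k = l + 6" using assms(1) by (metis add.commute le_Suc_ex)
    show ?thesis using that unfolding spectrum_def l by (auto simp: power_add split: if_splits)
  qed
  have "h \<in> Hplus (k + m) k \<longleftrightarrow> h \<in> H (k + m) k \<and> 2 ^ (k - 1) < h" for h
    using pos[of h] by (auto simp: Hplus_def)
  moreover have "h \<in> H (k + m) k \<and> 2 ^ (k - 1) < h \<longleftrightarrow> h \<in> spectrum m k" for h
    using H_large_in_spectrum[OF assms(1), of h m] spectrum_in_H[OF assms, of h] large[of h] k by auto
  ultimately show ?thesis by blast
qed

text \<open>For \<open>m = 2\<close> the added number equals \<open>9 * 2 ^ (k - 4)\<close>, which
  \<open>spectrum 2 k\<close> already contains.\<close>

lemma spectrum_Suc:
  assumes "2 \<le> m" "Suc m < k"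
  shows "spectrum (Suc m) k = spectrum m k \<union> {2 ^ (k - 1) + 2 ^ (k - 1 - Suc m)}"
proof -
  have "{2 ^ (k - 1) + 2 ^ (k - 1 - n) |n. 3 \<le> n \<and> n \<le> Suc m \<and> n < k} =
      {2 ^ (k - 1) + (2::nat) ^ (k - 1 - n) |n. 3 \<le> n \<and> n \<le> m \<and> n < k} \<union> {2 ^ (k - 1) + 2 ^ (k - 1 - Suc m)}"
  proof -
    have "3 \<le> n \<and> n \<le> Suc m \<and> n < k \<longleftrightarrow> (3 \<le> n \<and> n \<le> m \<and> n < k) \<or> n = Suc m" for n
      using assms by auto
    then show ?thesis by blast
  qed
  then show ?thesis using assms(1) unfolding spectrum_def by (simp add: Un_assoc)
qed

lemma spectrum_stable:
  assumes "k - 1 \<le> m" "3 \<le> k"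
  shows "spectrum m k = spectrum (k - 1) k"
proof -
  have "n \<le> m \<and> n < k \<longleftrightarrow> n \<le> k - 1 \<and> n < k" for n using assms by auto
  then have "{2 ^ (k - 1) + 2 ^ (k - 1 - n) |n. 3 \<le> n \<and> n \<le> m \<and> n < k} =
      {2 ^ (k - 1) + (2::nat) ^ (k - 1 - n) |n. 3 \<le> n \<and> n \<le> k - 1 \<and> n < k}" by (simp only:)
  moreover have "2 \<le> m" "2 \<le> k - 1" using assms by auto
  ultimately show ?thesis unfolding spectrum_def by (simp only: if_True)
qed

theorem theorem3p4:
  fixes k :: nat
  assumes "k \<ge> 6"
  shows "Hplus (k+1) k = {2^(k-1) + 2^(k-5) + 2^(k-6), 2^(k-1) + 2^(k-3), 2^(k-1) + 2^(k-2), 2^k}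
       \<and> Hplus (k+2) k = Hplus (k+1) k \<union> {2^(k-1) + 2^(k-4)}
       \<and> (\<forall>i. 3 \<le> i \<and> i \<le> k-1 \<longrightarrow> Hplus (k+i) k = Hplus (k+i-1) k \<union> {2^(k-1) + 2^(k-(i+1))})
       \<and> (\<forall>i\<ge>k. Hplus (k+i) k = Hplus (2*k-1) k)"
proof (intro conjI allI impI)
  obtain l where l: "k = l + 6" using assms by (metis add.commute le_Suc_ex)
  have c: "{2 ^ (k - 1) + (2::nat) ^ (k - 1 - n) |n. 3 \<le> n \<and> n \<le> 1 \<and> n < k} = {}"
    "{2 ^ (k - 1) + (2::nat) ^ (k - 1 - n) |n. 3 \<le> n \<and> n \<le> 2 \<and> n < k} = {}" by auto
  show "Hplus (k+1) k = {2^(k-1) + 2^(k-5) + 2^(k-6), 2^(k-1) + 2^(k-3), 2^(k-1) + 2^(k-2), 2^k}"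
    unfolding Hplus_eq_spectrum[OF assms order_refl] spectrum_def c unfolding l by (auto simp: power_add)
  show "Hplus (k+2) k = Hplus (k+1) k \<union> {2^(k-1) + 2^(k-4)}"
    unfolding Hplus_eq_spectrum[OF assms order_refl] Hplus_eq_spectrum[OF assms one_le_numeral] spectrum_def c
    unfolding l by (auto simp: power_add)
next
  fix i assume i: "3 \<le> i \<and> i \<le> k - 1"
  then obtain m where m: "i = Suc m" "2 \<le> m" by (cases i) auto
  have "Hplus (k + Suc m) k = Hplus (k + m) k \<union> {2 ^ (k - 1) + 2 ^ (k - 1 - Suc m)}"
    using Hplus_eq_spectrum[OF assms, of m] Hplus_eq_spectrum[OF assms, of "Suc m"] spectrum_Suc[of m k] i m assms by simp
  then show "Hplus (k+i) k = Hplus (k+i-1) k \<union> {2^(k-1) + 2^(k-(i+1))}" using m by simp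
next
  fix i assume "k \<le> i"
  then have "Hplus (k + i) k = spectrum (k - 1) k"
    using Hplus_eq_spectrum[OF assms, of i] spectrum_stable[of k i] assms by simp
  moreover have "2 * k - 1 = k + (k - 1)" using assms by simp
  ultimately show "Hplus (k+i) k = Hplus (2*k-1) k"
    using Hplus_eq_spectrum[OF assms, of "k - 1"] assms by simp
qed

end
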